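(* Let $W=(W(t))_{0\le t\le 1}$ be a Brownian motion. For all $r\in[1,\infty[$ and for all $p\in[1,\infty[$ there exist $\lambda\in[1,\infty[$ and $c>0$ such that $$\left( \operatorname{E}\left( \left| \Delta_{n,\lambda}(W) \right|^p \right) \right)^{1/p} \le c\cdot n^{-r}$$ for all $n\in\mathbb{N}$, where $\Delta_{n,\lambda}(W)$ is the error, after $n$ function evaluations, of the adaptive minimization algorithm with parameter $\lambda$ (defined in the context) applied to the paths of $W$.
   Context: $\mathbb{N}=\{1,2,\ldots\}$; $\log$ is the natural logarithm; $W$ is a standard one-dimensional Brownian motion on $[0,1]$ with continuous paths and $W(0)=0$. Algorithm. Fix a parameter $\lambda\in[1,\infty[$ and let $g(x)=\sqrt{\lambda x\log(1/x)}$ for $x\in]0,1]$. Let $f\colon[0,1]\to\mathbb{R}$ be continuous with $f(0)=0$. A sequence $t_0,t_1,\ldots\in[0,1]$ of pairwise distinct points is defined recursively. Set $t_0=0$, $t_1=1$, $t_2=1/2$. For each $n$ write $0\le t^n_0<t^n_1<\cdots<t^n_n\le 1$ for the points $t_0,\ldots,t_n$ in increasing order, and set $M_n=\min_{0\le i\le n}f(t_i)$ and, for $n\ge1$, $\tau_n=\min_{1\le i\le n}(t^n_i-t^n_{i-1})$. Given $t_0,\ldots,t_n$ with $n\ge2$, define for $1\le i\le n$ $$\rho^n_i=\frac{t^n_i-t^n_{i-1}}{\left(f(t^n_{i-1})-M_n+g(\tau_n)\right)\left(f(t^n_i)-M_n+g(\tau_n)\right)},\qquad \rho^n=\max_{1\le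 i\le n}\rho^n_i,$$ let $j$ be the smallest index with $\rho^n_j=\rho^n$, and set $t_{n+1}=\frac12(t^n_{j-1}+t^n_j)$. With $M=\inf_{0\le t\le1}f(t)$, the error is $\Delta_n=\Delta_{n,\lambda}(f)=M_n-M$. All these quantities depend on $\lambda$ and $f$. For $f=W$ they are random. *)

theory Defs
  imports "HOL-Probability.Probability"
begin

text \<open>
  Standard one-dimensional Brownian motion on the unit interval. All paths (not only almost all
  of them) start in 0 and are continuous. The values of \<open>W t\<close> for \<open>t\<close> outside
  \<open>{0..1}\<close> are unconstrained and never used.
\<close>

locale unit_brownian_motion = prob_space M for M :: "'a measure" +
  fixes W :: "real \<Rightarrow> 'a \<Rightarrow> real"
  assumes random_variable_W: "\<And>t. t \<in> {0..1} \<Longrightarrow> random_variable borel (W t)"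
    and start_at_0: "\<And>\<omega>. \<omega> \<in> space M \<Longrightarrow> W 0 \<omega> = 0"
    and continuous_paths: "\<And>\<omega>. \<omega> \<in> space M \<Longrightarrow> continuous_on {0..1} (\<lambda>t. W t \<omega>)"
    and normal_increments:
      "\<And>s t. \<lbrakk>0 \<le> s; s < t; t \<le> 1\<rbrakk> \<Longrightarrow>
        distributed M lborel (\<lambda>\<omega>. W t \<omega> - W s \<omega>) (normal_density 0 (sqrt (t - s)))"
    and indep_increments:
      "\<And>n (t :: nat \<Rightarrow> real). \<lbrakk>t ` {..n} \<subseteq> {0..1}; strict_mono_on {..n} t\<rbrakk> \<Longrightarrow>
        indep_vars (\<lambda>_. borel) (\<lambda>i \<omega>. W (t (Suc i)) \<omega> - W (t i) \<omega>) {..<n}"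

definition g :: "real \<Rightarrow> real \<Rightarrow> real" where
  "g lam x = sqrt (lam * x * ln (1 / x))"

text \<open>
  In the following definitions \<open>ts\<close> is the list \<open>[t\<^sub>0, \<dots>, t\<^sub>n]\<close> of the first
  \<open>n + 1 = length ts\<close> points, in the order in which they were chosen, so that
  \<open>sort ts ! i\<close> is the \<open>i\<close>-th point (from 0) in increasing order.
\<close>

definition min_value :: "(real \<Rightarrow> real) \<Rightarrow> real list \<Rightarrow> real" where
  "min_value f ts = Min (f ` set ts)"

definition min_gap :: "real list \<Rightarrow> real" where
  "min_gap ts = Min ((\<lambda>i. sort ts ! i - sort ts ! (i - 1)) ` {1..<length ts})"

definition rho :: "real \<Rightarrow> (real \<Rightarrow> real) \<Rightarrow> real list \<Rightarrow> nat \<Rightarrow> real" where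
  "rho lam f ts i =
    (sort ts ! i - sort ts ! (i - 1)) /
    ((f (sort ts ! (i - 1)) - min_value f ts + g lam (min_gap ts)) *
     (f (sort ts ! i) - min_value f ts + g lam (min_gap ts)))"

definition split_index :: "real \<Rightarrow> (real \<Rightarrow> real) \<Rightarrow> real list \<Rightarrow> nat" where
  "split_index lam f ts =
    (LEAST j. j \<in> {1..<length ts} \<and> rho lam f ts j = Max (rho lam f ts ` {1..<length ts}))"

definition next_point :: "real \<Rightarrow> (real \<Rightarrow> real) \<Rightarrow> real list \<Rightarrow> real" where
  "next_point lam f ts =
    (sort ts ! (split_index lam f ts - 1) + sort ts ! split_index lam f ts) / 2"

fun point :: "real \<Rightarrow> (real \<Rightarrow> real) \<Rightarrow> nat \<Rightarrow> real" where
  "point lam f 0 = 0"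
| "point lam f (Suc 0) = 1"
| "point lam f (Suc (Suc 0)) = 1 / 2"
| "point lam f (Suc (Suc (Suc n))) =
    next_point lam f (map (point lam f) [0..<Suc (Suc (Suc n))])"

definition minimization_error :: "real \<Rightarrow> nat \<Rightarrow> (real \<Rightarrow> real) \<Rightarrow> real" where
  "minimization_error lam n f =
    min_value f (map (point lam f) [0..<Suc n]) - (INF t\<in>{0..1}. f t)"

end

theory Submission
  imports Defs "HOL-Real_Asymp.Real_Asymp"
begin

text \<open>
  Why the error decays faster than every power of \<open>n\<close>.

  All gaps between neighbouring points are powers of \<open>1/2\<close>. Call \<open>f c - M\<^sub>n + g(\<tau>\<^sub>n)\<close> the offset of
  a point \<open>c\<close>; the denominator of \<open>\<rho>\<close> is the product of the offsets of the two endpoints. Let \<open>\<tau>\<close> be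
  the current smallest gap, and look back at the moment when an interval of length \<open>2\<tau>\<close> was
  halved for the first time. Both offsets of that interval were at least \<open>g(2\<tau>)\<close>, so the largest
  \<open>\<rho>\<close> was at most \<open>1 / (\<lambda> log(1/2\<tau>))\<close>, and hence in every interval of length \<open>h\<close> the product of the
  two offsets was at least \<open>\<lambda> h log(1/2\<tau>)\<close>. If the path dropped below \<open>M - g(2\<tau>)\<close> inside such an
  interval, both offsets would be smaller than its oscillation there, which for a Brownian path is
  of order \<open>sqrt(h log(1/2\<tau>))\<close>. For large \<open>\<lambda>\<close> this is a contradiction, so the error is at most
  \<open>g(2\<tau>)\<close> (\<open>error_le_twice_tau\<close>).

  It remains to see that \<open>\<tau>\<^sub>n\<close> falls below \<open>n\<close> to the power \<open>-4r\<close>. As long as it has not, only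
  \<open>O(log n)\<close> interval lengths occur. The interval next to the best point forces the largest \<open>\<rho>\<close> to be at
  least of order \<open>1 / log n\<close>; therefore an interval of length \<open>h\<close> is halved only if one of its endpoints has
  a value within a multiple of \<open>sqrt(h log n)\<close> of the minimum (\<open>split_near_min\<close>). So the number of
  steps is bounded by the number of such dyadic points on all levels (\<open>number_of_splits_le\<close>), and
  it suffices that on each level there are only about \<open>sqrt n\<close> of them.

  That is a statement about a Gaussian random walk. If \<open>i < j\<close> are both near-minimal, then the walk,
  started at \<open>i\<close> and run forwards over half the gap, never falls below its start by more than about
  \<open>sqrt(log n)\<close> standard deviations of one increment, and neither does the walk started at \<open>j\<close> and
  run backwards. By the reflection principle
  (\<open>walk_stays_above\<close>) each of the two has probability \<open>O(1 / sqrt(j - i))\<close> up to logarithms, and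
  they are independent, so a gap costs a factor \<open>1 / (j - i)\<close>, whose sum over all gaps is merely a
  logarithm. The expected number of \<open>Q\<close>-tuples of near-minimal points is thus at most a fixed
  power of \<open>n\<close> times the \<open>Q\<close>-th power of a logarithm, whereas \<open>sqrt n\<close> such points
  would yield of order \<open>n\<close> to the \<open>Q/2\<close> tuples. A large \<open>Q\<close> makes the exceptional event as
  rare as desired (\<open>prob_many_near_min_le\<close>).

  Off that event the error is \<open>O(n\<^sup>-\<^sup>r)\<close>; on it, all moments of the error are bounded uniformly in \<open>n\<close>,
  because the oscillation of the path has Gaussian tails (\<open>nn_integral_error_moment_le\<close>).
\<close>

section \<open>Consecutive points and the smallest gap\<close>

definition adjacent :: "real set \<Rightarrow> real \<Rightarrow> real \<Rightarrow> bool" where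
  "adjacent S a b \<longleftrightarrow> a \<in> S \<and> b \<in> S \<and> a < b \<and> (\<forall>c\<in>S. \<not> (a < c \<and> c < b))"

text \<open>
  This translates between positions in the sorted list, in terms of which the algorithm is defined,
  and neighbouring points of a set, which behave well when a point is inserted.
\<close>

lemma adjacent_iff_sort_nth:
  assumes "distinct ts"
  shows "adjacent (set ts) a b \<longleftrightarrow>
    (\<exists>i\<in>{1..<length ts}. a = sort ts ! (i - 1) \<and> b = sort ts ! i)"
proof
  have st: "sorted_wrt (<) (sort ts)"
    using assms by (simp add: strict_sorted_iff)
  have less: "sort ts ! i < sort ts ! j \<longleftrightarrow> i < j" if "i < length ts" "j < length ts" for i j
  proof -
    have "sort ts ! i < sort ts ! j" if "i < j" "j < length ts" for i j
      using sorted_wrt_nth_less[OF st that(1)] that by simp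
    then show ?thesis
      using that by (metis linorder_less_linear order_less_asym)
  qed
  have mem: "\<exists>i<length ts. c = sort ts ! i" if "c \<in> set ts" for c
    using that by (metis in_set_conv_nth length_sort set_sort)
  show "\<exists>i\<in>{1..<length ts}. a = sort ts ! (i - 1) \<and> b = sort ts ! i" if "adjacent (set ts) a b"
  proof -
    from that obtain i j where ij: "i < length ts" "a = sort ts ! i" "j < length ts" "b = sort ts ! j"
      using mem unfolding adjacent_def by metis
    have "i < j" using that ij less unfolding adjacent_def by blast
    moreover have "\<not> Suc i < j"
    proof
      assume "Suc i < j"
      then have "a < sort ts ! Suc i" "sort ts ! Suc i < b"
        using ij less by auto
      moreover have "sort ts ! Suc i \<in> set ts"
        using \<open>Suc i < j\<close> ij by (metis length_sort nth_mem order.strict_trans set_sort)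
      ultimately show False using that unfolding adjacent_def by blast
    qed
    ultimately have "j = Suc i" by simp
    then show ?thesis using ij by (intro bexI[of _ j]) auto
  qed
  show "adjacent (set ts) a b" if "\<exists>i\<in>{1..<length ts}. a = sort ts ! (i - 1) \<and> b = sort ts ! i"
  proof -
    from that obtain i where i: "1 \<le> i" "i < length ts" "a = sort ts ! (i - 1)" "b = sort ts ! i"
      by auto
    have "a \<in> set ts" "b \<in> set ts"
      using i by (metis length_sort nth_mem order.strict_trans1 diff_le_self set_sort)+
    moreover have "a < b" using i less by simp
    moreover have "\<not> (a < c \<and> c < b)" if c: "c \<in> set ts" for c
    proof
      assume *: "a < c \<and> c < b"
      obtain l where l: "l < length ts" "c = sort ts ! l" using mem[OF c] by blast
      have "i - 1 < l" "l < i" using * l i less by auto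
      then show False by simp
    qed
    ultimately show ?thesis unfolding adjacent_def by blast
  qed
qed

definition rho_pair :: "real \<Rightarrow> (real \<Rightarrow> real) \<Rightarrow> real list \<Rightarrow> real \<Rightarrow> real \<Rightarrow> real" where
  "rho_pair lam f ts a b = (b - a) /
    ((f a - min_value f ts + g lam (min_gap ts)) * (f b - min_value f ts + g lam (min_gap ts)))"

lemma min_gap_le:
  assumes "distinct ts" "adjacent (set ts) a b"
  shows "min_gap ts \<le> b - a"
  using assms unfolding adjacent_iff_sort_nth[OF assms(1)] min_gap_def
  by (auto intro!: Min_le)

lemma min_gap_attained:
  assumes "distinct ts" "2 \<le> length ts"
  obtains a b where "adjacent (set ts) a b" "min_gap ts = b - a"
proof -
  have "min_gap ts \<in> (\<lambda>i. sort ts ! i - sort ts ! (i - 1)) ` {1..<length ts}"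
    unfolding min_gap_def using assms by (intro Min_in) auto
  then show ?thesis
    using that adjacent_iff_sort_nth[OF assms(1)] by blast
qed

lemma next_point_midpoint:
  assumes "distinct ts" "2 \<le> length ts"
  obtains a b where "adjacent (set ts) a b" "next_point lam f ts = (a + b) / 2"
    "\<And>c d. adjacent (set ts) c d \<Longrightarrow> rho_pair lam f ts c d \<le> rho_pair lam f ts a b"
proof -
  let ?I = "{1..<length ts}" and ?j = "split_index lam f ts"
  have "Max (rho lam f ts ` ?I) \<in> rho lam f ts ` ?I"
    using assms by (intro Max_in) auto
  then have "\<exists>j. j \<in> ?I \<and> rho lam f ts j = Max (rho lam f ts ` ?I)" by auto
  from LeastI_ex[OF this] have j: "?j \<in> ?I" "rho lam f ts ?j = Max (rho lam f ts ` ?I)"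
    unfolding split_index_def by blast+
  show ?thesis
  proof
    show "adjacent (set ts) (sort ts ! (?j - 1)) (sort ts ! ?j)"
      using j adjacent_iff_sort_nth[OF assms(1)] by blast
    show "next_point lam f ts = (sort ts ! (?j - 1) + sort ts ! ?j) / 2"
      by (simp add: next_point_def)
    fix c d assume "adjacent (set ts) c d"
    then obtain i where i: "i \<in> ?I" "c = sort ts ! (i - 1)" "d = sort ts ! i"
      using adjacent_iff_sort_nth[OF assms(1)] by blast
    have "rho lam f ts i \<le> rho lam f ts ?j" unfolding j(2) using i by (intro Max_ge) auto
    then show "rho_pair lam f ts c d \<le> rho_pair lam f ts (sort ts ! (?j - 1)) (sort ts ! ?j)"
      by (simp add: rho_def rho_pair_def i)
  qed
qed

text \<open>
  The \<open>n\<close> gaps add up to at most the length of the unit interval. This first, weak bound on the smallest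
  gap already shows that its level is at least of order \<open>log n\<close>.
\<close>

lemma length_times_min_gap_le:
  assumes "distinct ts" "set ts \<subseteq> {0..1}" "length ts = Suc n"
  shows "real n * min_gap ts \<le> 1"
proof -
  have *: "sort ts ! 0 + real j * min_gap ts \<le> sort ts ! j" if "j \<le> n" for j
    using that
  proof (induction j)
    case (Suc j)
    have "min_gap ts \<le> sort ts ! Suc j - sort ts ! j"
      using Suc assms unfolding min_gap_def by (intro Min_le) (auto intro!: image_eqI[of _ _ "Suc j"])
    then show ?case using Suc by (simp add: algebra_simps)
  qed simp
  have "sort ts ! 0 \<in> {0..1}" "sort ts ! n \<in> {0..1}"
    using assms by (metis length_sort lessI nth_mem set_sort subset_iff zero_less_Suc)+
  then show ?thesis using *[of n] by auto
qed

definition points :: "real \<Rightarrow> (real \<Rightarrow> real) \<Rightarrow> nat \<Rightarrow> real list" where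
  "points lam f n = map (point lam f) [0..<Suc n]"

definition dyadic_pair :: "nat \<Rightarrow> real \<Rightarrow> real \<Rightarrow> bool" where
  "dyadic_pair k a b \<longleftrightarrow> (\<exists>j<2 ^ k. a = real j / 2 ^ k \<and> b = real (Suc j) / 2 ^ k)"

lemma dyadic_pair_length: "dyadic_pair k a b \<Longrightarrow> b - a = 1 / 2 ^ k"
  by (auto simp: dyadic_pair_def field_simps)

lemma dyadic_pair_halves:
  assumes "dyadic_pair k a b"
  shows "dyadic_pair (Suc k) a ((a + b) / 2)" "dyadic_pair (Suc k) ((a + b) / 2) b"
proof -
  obtain j where j: "j < 2 ^ k" "a = real j / 2 ^ k" "b = real (Suc j) / 2 ^ k"
    using assms unfolding dyadic_pair_def by blast
  show "dyadic_pair (Suc k) a ((a + b) / 2)" unfolding dyadic_pair_def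
    using j by (intro exI[of _ "2 * j"]) (auto simp: field_simps)
  show "dyadic_pair (Suc k) ((a + b) / 2) b" unfolding dyadic_pair_def
    using j by (intro exI[of _ "2 * j + 1"]) (auto simp: field_simps)
qed

text \<open>
  Halving one gap leaves all other gaps alone.
\<close>

lemma adjacent_insert_midpoint:
  assumes "adjacent S a b" "adjacent (insert ((a + b) / 2) S) c d"
  shows "adjacent S c d \<or> (c = a \<and> d = (a + b) / 2) \<or> (c = (a + b) / 2 \<and> d = b)"
proof -
  let ?m = "(a + b) / 2"
  have m: "a < ?m" "?m < b" using assms(1) unfolding adjacent_def by auto
  have cd: "c \<in> insert ?m S" "d \<in> insert ?m S" "c < d"
    "\<And>e. e \<in> S \<Longrightarrow> \<not> (c < e \<and> e < d)" "\<not> (c < ?m \<and> ?m < d)"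
    using assms(2) unfolding adjacent_def by auto
  have ab: "a \<in> S" "b \<in> S" "a < b" "\<And>e. e \<in> S \<Longrightarrow> e \<le> a \<or> b \<le> e"
    using assms(1) unfolding adjacent_def by force+
  consider "c = ?m" | "c \<noteq> ?m" "d = ?m" | "c \<noteq> ?m" "d \<noteq> ?m" by blast
  then show ?thesis
  proof cases
    case 1
    then have "d \<in> S" using cd by auto
    then have "b \<le> d" using ab(4)[of d] 1 cd m by linarith
    then have "d = b" using cd(4)[OF ab(2)] 1 m by linarith
    then show ?thesis using 1 by blast
  next
    case 2
    then have "c \<in> S" using cd by auto
    then have "c \<le> a" using ab(4)[of c] 2 cd m by linarith
    then have "c = a" using cd(4)[OF ab(1)] 2 m by linarith
    then show ?thesis using 2 by blast
  next
    case 3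
    then show ?thesis using cd unfolding adjacent_def by blast
  qed
qed

definition dyadic_partition :: "real set \<Rightarrow> bool" where
  "dyadic_partition S \<longleftrightarrow> 0 \<in> S \<and> 1 \<in> S \<and> S \<subseteq> {0..1} \<and>
    (\<forall>a b. adjacent S a b \<longrightarrow> (\<exists>k\<ge>1. dyadic_pair k a b))"

lemma points_Suc: "points lam f (Suc n) = points lam f n @ [point lam f (Suc n)]"
  by (simp add: points_def)

lemma length_points [simp]: "length (points lam f n) = Suc n"
  by (simp add: points_def)

lemma set_points_Suc: "set (points lam f (Suc n)) = insert (point lam f (Suc n)) (set (points lam f n))"
  unfolding points_Suc by (simp only: set_append list.set Un_insert_right Un_empty_right)

lemma points_2: "points lam f 2 = [0, 1, 1 / 2]"
  by (simp add: points_def numeral_2_eq_2)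

lemma point_Suc:
  assumes "2 \<le> n"
  shows "point lam f (Suc n) = next_point lam f (points lam f n)"
proof -
  obtain i where "n = Suc (Suc i)" using assms by (metis add_2_eq_Suc le_Suc_ex)
  then show ?thesis by (simp only: point.simps points_def)
qed

lemma points_dyadic_partition:
  assumes "2 \<le> n"
  shows "distinct (points lam f n) \<and> dyadic_partition (set (points lam f n))"
  using assms
proof (induction n rule: dec_induct)
  case base
  have "\<exists>k\<ge>1. dyadic_pair k a b" if "adjacent {0, 1, 1/2} a b" for a b :: real
  proof -
    have "(a = 0 \<and> b = 1/2) \<or> (a = 1/2 \<and> b = 1)"
      using that unfolding adjacent_def by auto
    then have "dyadic_pair 1 a b" unfolding dyadic_pair_def
      by (auto intro: exI[of _ 0] exI[of _ 1])
    then show ?thesis by blast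
  qed
  then show ?case unfolding points_2 dyadic_partition_def by auto
next
  case (step n)
  let ?S = "set (points lam f n)"
  have d: "distinct (points lam f n)" and S: "dyadic_partition ?S" using step by auto
  obtain a b where ab: "adjacent ?S a b" "point lam f (Suc n) = (a + b) / 2"
    using next_point_midpoint[OF d, of lam f] step point_Suc[of n lam f] by (metis le_SucI length_points)
  have new: "(a + b) / 2 \<notin> ?S"
    using ab(1) unfolding adjacent_def by auto
  have set: "set (points lam f (Suc n)) = insert ((a + b) / 2) ?S"
    unfolding set_points_Suc ab(2) ..
  obtain k where k: "k \<ge> 1" "dyadic_pair k a b" using S ab unfolding dyadic_partition_def by blast
  have "\<exists>k\<ge>1. dyadic_pair k c d" if cd: "adjacent (insert ((a + b) / 2) ?S) c d" for c d
  proof -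
    consider "adjacent ?S c d" | "c = a" "d = (a + b) / 2" | "c = (a + b) / 2" "d = b"
      using adjacent_insert_midpoint[OF ab(1) cd] by blast
    then show ?thesis
    proof cases
      case 1
      then show ?thesis using S unfolding dyadic_partition_def by blast
    qed (use k dyadic_pair_halves[OF k(2)] in \<open>metis le_SucI\<close>)+
  qed
  moreover have "(a + b) / 2 \<in> {0..1}"
  proof -
    have "a \<in> {0..1}" "b \<in> {0..1}"
      using ab(1) S unfolding adjacent_def dyadic_partition_def by blast+
    then show ?thesis by simp
  qed
  ultimately have "dyadic_partition (insert ((a + b) / 2) ?S)"
    using S unfolding dyadic_partition_def by auto
  moreover have "distinct (points lam f (Suc n))"
    unfolding points_Suc ab(2) using d new by simp
  ultimately show ?case unfolding set by blast
qed

lemma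
  assumes "2 \<le> n"
  shows distinct_points: "distinct (points lam f n)"
    and dyadic_partition_points: "dyadic_partition (set (points lam f n))"
  using points_dyadic_partition[OF assms] by blast+

abbreviation tau :: "real \<Rightarrow> (real \<Rightarrow> real) \<Rightarrow> nat \<Rightarrow> real" where
  "tau lam f n \<equiv> min_gap (points lam f n)"

abbreviation point_set :: "real \<Rightarrow> (real \<Rightarrow> real) \<Rightarrow> nat \<Rightarrow> real set" where
  "point_set lam f n \<equiv> set (points lam f n)"

definition splits :: "real \<Rightarrow> (real \<Rightarrow> real) \<Rightarrow> nat \<Rightarrow> real \<Rightarrow> real \<Rightarrow> bool" where
  "splits lam f n a b \<longleftrightarrow> adjacent (point_set lam f n) a b \<and> point lam f (Suc n) = (a + b) / 2 \<and>
    (\<forall>c d. adjacent (point_set lam f n) c d \<longrightarrow>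
      rho_pair lam f (points lam f n) c d \<le> rho_pair lam f (points lam f n) a b)"

lemma splits_exists:
  assumes "2 \<le> n"
  obtains a b where "splits lam f n a b"
  using next_point_midpoint[OF distinct_points[OF assms], of lam f] assms point_Suc[OF assms]
  unfolding splits_def by (metis le_SucI length_points)

lemma tau_dyadic:
  assumes "2 \<le> n"
  obtains k where "1 \<le> k" "tau lam f n = 1 / 2 ^ k"
proof -
  have "distinct (points lam f n)" "2 \<le> length (points lam f n)"
    using assms distinct_points[OF assms] by auto
  from min_gap_attained[OF this] obtain a b
    where "adjacent (point_set lam f n) a b" "tau lam f n = b - a" by metis
  then show ?thesis using that dyadic_partition_points[OF assms] dyadic_pair_length
    unfolding dyadic_partition_def by metis
qed

lemma adjacent_dyadic:
  assumes "2 \<le> n" "adjacent (point_set lam f n) a b"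
  obtains k where "1 \<le> k" "dyadic_pair k a b"
  using dyadic_partition_points[OF assms(1)] assms(2) that unfolding dyadic_partition_def by blast

lemma tau_2: "tau lam f 2 = 1 / 2"
proof -
  have "distinct [0, 1, 1 / 2 :: real]" "2 \<le> length [0, 1, 1 / 2 :: real]" by auto
  from min_gap_attained[OF this] obtain a b
    where "adjacent {0, 1, 1 / 2} a b" "min_gap [0, 1, 1 / 2] = b - a"
    by (metis list.set(1,2))
  then show ?thesis unfolding points_2 adjacent_def by auto
qed

text \<open>
  The smallest gap can only change when an interval of that very length is halved: gaps are
  powers of \<open>1/2\<close>, so half of a longer one is not smaller than the smallest gap.
\<close>

lemma tau_Suc:
  assumes "2 \<le> n" "splits lam f n a b"
  shows "tau lam f (Suc n) = tau lam f n \<or> (b - a = tau lam f n \<and> tau lam f (Suc n) = tau lam f n / 2)"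
proof -
  have ab: "adjacent (point_set lam f n) a b" using assms unfolding splits_def by blast
  have set: "point_set lam f (Suc n) = insert ((a + b) / 2) (point_set lam f n)"
    using assms unfolding splits_def set_points_Suc by metis
  have le: "tau lam f n \<le> d - c" if "adjacent (point_set lam f n) c d" for c d
    using min_gap_le[OF distinct_points] that assms by blast
  have le': "tau lam f (Suc n) \<le> d - c" if "adjacent (point_set lam f (Suc n)) c d" for c d
    using min_gap_le[OF distinct_points] that assms by (metis le_SucI)
  have halves: "adjacent (point_set lam f (Suc n)) a ((a + b) / 2)"
    using ab unfolding set adjacent_def by auto
  have "distinct (points lam f (Suc n))" "2 \<le> length (points lam f (Suc n))"
    using assms by (auto intro!: distinct_points)
  from min_gap_attained[OF this] obtain c d
    where cd: "adjacent (point_set lam f (Suc n)) c d" "tau lam f (Suc n) = d - c" by metis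
  have "distinct (points lam f n)" "2 \<le> length (points lam f n)"
    using assms by (auto intro!: distinct_points)
  from min_gap_attained[OF this] obtain u v
    where uv: "adjacent (point_set lam f n) u v" "tau lam f n = v - u" by metis
  obtain k where k: "b - a = 1 / 2 ^ k"
    using adjacent_dyadic[OF assms(1) ab] dyadic_pair_length by metis
  obtain l where l: "tau lam f n = 1 / 2 ^ l" using tau_dyadic[OF assms(1)] by blast
  have le_half: "tau lam f (Suc n) \<le> (b - a) / 2" using le'[OF halves] by (simp add: field_simps)
  have half: "tau lam f (Suc n) \<le> tau lam f n"
  proof (cases "u = a \<and> v = b")
    case True
    then show ?thesis using le_half uv ab unfolding adjacent_def by auto
  next
    case False
    have "v \<le> a \<or> b \<le> u \<or> (u = a \<and> v = b)"
      using uv(1) ab unfolding adjacent_def by (meson linorder_neqE_linordered_idom not_less)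
    with False have "\<not> (u < (a + b) / 2 \<and> (a + b) / 2 < v)"
      using ab unfolding adjacent_def by auto
    then have "adjacent (point_set lam f (Suc n)) u v" using uv(1) unfolding set adjacent_def by auto
    then show ?thesis using le' uv by auto
  qed
  have "adjacent (point_set lam f n) c d \<or> d - c = (b - a) / 2"
    using adjacent_insert_midpoint[OF ab cd(1)[unfolded set]] by (auto simp: field_simps)
  then consider "tau lam f n \<le> tau lam f (Suc n)" | "tau lam f (Suc n) = (b - a) / 2" "tau lam f (Suc n) < tau lam f n"
    using le cd(2) half by force
  then show ?thesis
  proof cases
    case 1
    then show ?thesis using half by linarith
  next
    case 2
    then have *: "1 / 2 ^ k \<ge> (1 / 2 ^ l :: real)" "1 / 2 ^ Suc k < (1 / 2 ^ l :: real)"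
      using le[OF ab] k l by auto
    then have "(2::real) ^ k \<le> 2 ^ l" "(2::real) ^ l < 2 ^ Suc k"
      by (auto simp: field_simps)
    then have "k \<le> l" "l < Suc k" by (auto simp: power_strict_increasing_iff simp del: power_Suc)
    then have "k = l" by simp
    then show ?thesis using 2 k l by simp
  qed
qed

text \<open>
  Going back to the step at which the present smallest gap first occurred. At that step the
  halved interval was itself a shortest one, which makes its \<open>\<rho>\<close> small.
\<close>

lemma split_of_twice_tau:
  assumes "2 \<le> n" "tau lam f n < 1 / 2"
  obtains i a b where "2 \<le> i" "i < n" "splits lam f i a b" "b - a = 2 * tau lam f n"
    "tau lam f i = 2 * tau lam f n"
proof -
  have "\<exists>i a b. 2 \<le> i \<and> i < n \<and> splits lam f i a b \<and> b - a = 2 * tau lam f n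
    \<and> tau lam f i = 2 * tau lam f n"
    using assms
  proof (induction n rule: dec_induct)
    case base
    then show ?case using tau_2[of lam f] by linarith
  next
    case (step n)
    obtain a b where ab: "splits lam f n a b" using splits_exists[OF step(1)] by blast
    from tau_Suc[OF step(1) ab] show ?case
    proof
      assume *: "tau lam f (Suc n) = tau lam f n"
      then show ?thesis using step unfolding * by (metis less_SucI)
    next
      assume *: "b - a = tau lam f n \<and> tau lam f (Suc n) = tau lam f n / 2"
      then have "2 * tau lam f (Suc n) = tau lam f n" by linarith
      then show ?thesis using * ab step by (metis lessI)
    qed
  qed
  then show ?thesis using that by blast
qed

lemma tau_antimono:
  assumes "2 \<le> i" "i \<le> n"
  shows "tau lam f n \<le> tau lam f i"
  using assms(2)
proof (induction n rule: dec_induct)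
  case (step n)
  have "2 \<le> n" using assms step by simp
  moreover obtain k where "tau lam f n = 1 / 2 ^ k" using tau_dyadic[OF \<open>2 \<le> n\<close>] by blast
  moreover obtain a b where "splits lam f n a b" using splits_exists[OF \<open>2 \<le> n\<close>] by blast
  ultimately have "tau lam f (Suc n) \<le> tau lam f n"
    using tau_Suc[of n lam f a b] by (smt (verit) divide_pos_pos field_sum_of_halves zero_less_one zero_less_power)
  then show ?case using step by linarith
qed simp

lemma min_value_antimono:
  assumes "i \<le> n"
  shows "min_value f (points lam f n) \<le> min_value f (points lam f i)"
  unfolding min_value_def points_def set_map using assms by (intro Min_antimono image_mono) auto

section \<open>The error on a path with a logarithmic modulus of continuity\<close>

lemma g_dyadic: "g lam (1 / 2 ^ t) = sqrt (lam * real t * ln 2 / 2 ^ t)"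
  unfolding g_def by (simp add: ln_realpow)

lemma adjacent_around:
  assumes "finite S" "0 \<in> S" "1 \<in> S" "u \<in> {0..1}" "u \<notin> S"
  obtains c d where "adjacent S c d" "c < u" "u < d"
proof -
  let ?C = "{s\<in>S. s < u}" and ?D = "{s\<in>S. u < s}"
  have "u \<noteq> 0" "u \<noteq> 1" using assms by auto
  then have ne: "?C \<noteq> {}" "?D \<noteq> {}" using assms by (force intro: exI[of _ 0] exI[of _ 1])+
  have fin: "finite ?C" "finite ?D" using assms by auto
  have "Max ?C \<in> ?C" "Min ?D \<in> ?D" using Max_in[OF fin(1) ne(1)] Min_in[OF fin(2) ne(2)] by auto
  moreover have "s \<le> Max ?C \<or> Min ?D \<le> s" if "s \<in> S" for s
    using that assms(5) fin by (metis (mono_tags, lifting) Max_ge Min_le linorder_less_linear mem_Collect_eq)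
  ultimately show ?thesis
    using that[of "Max ?C" "Min ?D"] unfolding adjacent_def by force
qed

lemma adjacent_at:
  assumes "finite S" "0 \<in> S" "1 \<in> S" "S \<subseteq> {0..1}" "u \<in> S"
  obtains v where "adjacent S u v \<or> adjacent S v u"
proof (cases "u = 1")
  case True
  let ?C = "{s\<in>S. s < u}"
  have "?C \<noteq> {}" "finite ?C" using True assms by auto
  then have "Max ?C \<in> ?C" by (intro Max_in)
  moreover have "s \<le> Max ?C \<or> u \<le> s" if "s \<in> S" for s
    using that \<open>finite ?C\<close> by (metis (mono_tags, lifting) Max_ge linorder_not_le mem_Collect_eq)
  ultimately have "adjacent S (Max ?C) u" using assms unfolding adjacent_def by force
  then show ?thesis using that by blast
next
  case False
  let ?D = "{s\<in>S. u < s}"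
  have "?D \<noteq> {}" "finite ?D" using False assms by force+
  then have "Min ?D \<in> ?D" by (intro Min_in)
  moreover have "s \<le> u \<or> Min ?D \<le> s" if "s \<in> S" for s
    using that \<open>finite ?D\<close> by (metis (mono_tags, lifting) Min_le linorder_not_le mem_Collect_eq)
  ultimately have "adjacent S u (Min ?D)" using assms unfolding adjacent_def by force
  then show ?thesis using that by blast
qed

lemma inverse_le_div_iff:
  fixes A H x :: real
  assumes "0 < A" "0 < H" "0 < x"
  shows "1 / H \<le> (1 / x) / A \<longleftrightarrow> A \<le> H / x"
  using assms by (simp add: field_simps)

text \<open>
  For Brownian motion this holds with an absolute constant \<open>K\<close> outside an event of probability
  \<open>O(exp(-2L))\<close>. The term \<open>L\<close>, later a multiple of \<open>log n\<close>, pays for the few long intervals, on which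
  the factor \<open>k\<close> alone would not make the exceptional event rare.
\<close>

definition dyadic_modulus :: "(real \<Rightarrow> real) \<Rightarrow> real \<Rightarrow> real \<Rightarrow> bool" where
  "dyadic_modulus f K L \<longleftrightarrow> (\<forall>k a b. dyadic_pair k a b \<longrightarrow>
    (\<forall>s\<in>{a..b}. \<forall>t\<in>{a..b}. \<bar>f s - f t\<bar> \<le> K * sqrt ((real k + L) / 2 ^ k)))"

locale tame_path =
  fixes f :: "real \<Rightarrow> real" and lam K L :: real
  assumes cont: "continuous_on {0..1} f" and modulus: "dyadic_modulus f K L"
    and K_nonneg: "0 \<le> K" and L_nonneg: "0 \<le> L" and lam_ge_1: "1 \<le> lam"
begin

abbreviation "S n \<equiv> point_set lam f n"
abbreviation "best n \<equiv> min_value f (points lam f n)"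
abbreviation "tol n \<equiv> g lam (tau lam f n)"
abbreviation "infimum \<equiv> (INF t\<in>{0..1}. f t)"

text \<open>
  For a smallest gap \<open>\<tau> = 1/2\<^sup>t\<close>, the factor \<open>(t - 1) ln 2\<close> is \<open>log(1/2\<tau>)\<close>. The inequality says that
  \<open>\<lambda>\<close> beats the modulus of continuity on all intervals of length at least \<open>2\<tau>\<close>.
\<close>

abbreviation "level_ok t \<equiv> 2 \<le> t \<and> K\<^sup>2 * (real (t - 1) + L) \<le> lam * real (t - 1) * ln 2"
abbreviation "offset n c \<equiv> f c - best n + tol n"

lemma infimum_le: "t \<in> {0..1} \<Longrightarrow> infimum \<le> f t"
proof -
  have "compact (f ` {0..1})" using cont by (intro compact_continuous_image) auto
  then have "bdd_below (f ` {0..1})" by (simp add: bounded_imp_bdd_below compact_imp_bounded)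
  then show "t \<in> {0..1} \<Longrightarrow> infimum \<le> f t" by (intro cINF_lower)
qed

lemma best_le: "c \<in> S n \<Longrightarrow> best n \<le> f c"
  unfolding min_value_def by (intro Min_le) auto

lemma tol_pos:
  assumes "2 \<le> n"
  shows "0 < tol n"
proof -
  obtain k where "1 \<le> k" "tau lam f n = 1 / 2 ^ k" using tau_dyadic[OF assms] by blast
  then show ?thesis using lam_ge_1 by (simp add: g_dyadic)
qed

lemma S_facts:
  assumes "2 \<le> n"
  shows "finite (S n)" "0 \<in> S n" "1 \<in> S n" "S n \<subseteq> {0..1}"
  using dyadic_partition_points[OF assms] unfolding dyadic_partition_def by auto

lemma offset_ge: "c \<in> S n \<Longrightarrow> tol n \<le> offset n c"
  using best_le by simp

lemma rho_pair_offset: "rho_pair lam f (points lam f n) c d = (d - c) / (offset n c * offset n d)"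
  by (simp add: rho_pair_def)

lemma level_le_tau:
  assumes "2 \<le> n" "adjacent (S n) c d" "dyadic_pair k c d" "tau lam f n = 1 / 2 ^ t"
  shows "k \<le> t"
proof -
  have "1 / 2 ^ t \<le> (1 / 2 ^ k :: real)"
    using min_gap_le[OF distinct_points[OF assms(1)] assms(2)] assms dyadic_pair_length by metis
  then have "(2::real) ^ k \<le> 2 ^ t" by (simp add: field_simps)
  then show ?thesis by simp
qed

lemma modulus_le:
  assumes "dyadic_pair k a b" "s \<in> {a..b}" "t \<in> {a..b}" "k \<le> m"
  shows "f s - f t \<le> K * sqrt ((real m + L) / 2 ^ k)"
proof -
  have "f s - f t \<le> K * sqrt ((real k + L) / 2 ^ k)"
    using modulus assms unfolding dyadic_modulus_def by fastforce
  also have "\<dots> \<le> K * sqrt ((real m + L) / 2 ^ k)"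
    using assms K_nonneg by (intro mult_left_mono) (auto intro!: divide_right_mono)
  finally show ?thesis .
qed

text \<open>
  Let \<open>i\<close> be the step at which an interval of length \<open>2\<tau> = 1/2\<^sup>s\<close> was halved while it was a shortest
  one. Its offsets are at least \<open>G = g(2\<tau>)\<close>, so \<open>\<rho> \<le> 2\<tau>/G\<^sup>2\<close>, and by maximality all products of offsets
  are bounded from below. A value below \<open>M\<^sub>i - G\<close> would make both offsets of its interval smaller than
  the oscillation on that interval, whose square is too small for this by the assumption on the level.
\<close>

lemma error_le_twice_tau:
  assumes "2 \<le> n" "tau lam f n = 1 / 2 ^ t" "level_ok t"
  shows "best n - infimum \<le> g lam (1 / 2 ^ (t - 1))"
proof -
  obtain s where t: "t = Suc s" "1 \<le> s" using assms by (cases t) auto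
  let ?G = "g lam (1 / 2 ^ s)" and ?q = "lam * real s * ln 2"
  have q: "0 < ?q" using lam_ge_1 t by simp
  have ok: "K\<^sup>2 * (real s + L) \<le> ?q" using assms t by simp
  have "(1::real) / 2 ^ t < 1 / 2" using t assms by (simp add: field_simps)
  then obtain i a b where i: "2 \<le> i" "i < n" "splits lam f i a b" "b - a = 2 * tau lam f n"
    "tau lam f i = 2 * tau lam f n"
    using split_of_twice_tau[OF assms(1), of lam f] assms(2) by metis
  have tau_i: "tau lam f i = 1 / 2 ^ s" "b - a = 1 / 2 ^ s" using i assms t by auto
  have G: "tol i = ?G" "0 < ?G" "?G\<^sup>2 = ?q / 2 ^ s"
    using tau_i tol_pos[OF i(1)] q by (auto simp: g_dyadic)
  have ab: "adjacent (S i) a b" using i unfolding splits_def by blast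
  have product_ab: "?q / 2 ^ s \<le> offset i a * offset i b"
    unfolding G(3)[symmetric] power2_eq_square
    using offset_ge[of a i] offset_ge[of b i] ab G unfolding adjacent_def by (intro mult_mono) auto
  have pos: "0 < ?q / 2 ^ s" using q by simp
  have "0 < (?q / 2 ^ s) * (offset i a * offset i b)"
    by (rule mult_pos_pos[OF pos less_le_trans[OF pos product_ab]])
  then have "(1 / 2 ^ s) / (offset i a * offset i b) \<le> (1 / 2 ^ s) / (?q / 2 ^ s)"
    using product_ab by (intro divide_left_mono) (auto simp: mult.commute)
  then have rho_ab: "rho_pair lam f (points lam f i) a b \<le> 1 / ?q"
    unfolding rho_pair_offset tau_i by simp
  have product: "?q / 2 ^ k \<le> offset i c * offset i d" if cd: "adjacent (S i) c d" "dyadic_pair k c d" for c d k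
  proof -
    have "0 < offset i c" "0 < offset i d"
      using offset_ge[of c i] offset_ge[of d i] cd G unfolding adjacent_def by auto
    then have pos: "0 < offset i c * offset i d" by simp
    have *: "(1 / 2 ^ k) / (offset i c * offset i d) \<le> 1 / ?q"
    proof -
      have "rho_pair lam f (points lam f i) c d \<le> rho_pair lam f (points lam f i) a b"
        using i(3) cd(1) unfolding splits_def by blast
      then show ?thesis using rho_ab unfolding rho_pair_offset[of i c d] dyadic_pair_length[OF cd(2)]
        by linarith
    qed
    have "0 < (1 / 2 ^ k) / (offset i c * offset i d)" using pos by simp
    then have "inverse (1 / ?q) \<le> inverse ((1 / 2 ^ k) / (offset i c * offset i d))"
      using * by (intro le_imp_inverse_le)
    then have "?q \<le> 2 ^ k * (offset i c * offset i d)" by simp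
    then show ?thesis by (simp add: divide_le_eq mult.commute)
  qed
  have "best i - ?G \<le> f u" if u: "u \<in> {0..1}" for u
  proof (rule ccontr)
    assume "\<not> ?thesis"
    then have less: "f u < best i - ?G" by simp
    then have "u \<notin> S i" using best_le[of u i] G by auto
    then obtain c d where cd: "adjacent (S i) c d" "c < u" "u < d"
      using adjacent_around[of "S i" u] S_facts[OF i(1)] u by metis
    obtain k where k: "dyadic_pair k c d" using adjacent_dyadic[OF i(1) cd(1)] by blast
    have "k \<le> s" using level_le_tau[OF i(1) cd(1) k tau_i(1)] .
    let ?w = "K * sqrt ((real s + L) / 2 ^ k)"
    have "f c - f u \<le> ?w" "f d - f u \<le> ?w"
      using modulus_le[OF k _ _ \<open>k \<le> s\<close>] cd by auto
    then have "offset i c < ?w" "offset i d < ?w" "0 \<le> offset i c" "0 \<le> offset i d"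
      using less G offset_ge[of c i] offset_ge[of d i] cd(1) unfolding adjacent_def by auto
    then have "offset i c * offset i d < ?w * ?w"
      by (intro mult_strict_mono) auto
    also have "\<dots> = K\<^sup>2 * (real s + L) / 2 ^ k"
      using L_nonneg by (simp add: power2_eq_square[symmetric] power_mult_distrib)
    also have "\<dots> \<le> ?q / 2 ^ k" using ok by (intro divide_right_mono) auto
    finally show False using product[OF cd(1) k] by simp
  qed
  then have "best i - ?G \<le> infimum" by (intro cINF_greatest) auto
  moreover have "best n \<le> best i" using min_value_antimono i by simp
  ultimately show ?thesis using t by simp
qed

text \<open>
  This is chosen such that, on an interval of length \<open>h\<close> next to the best point, both offsets are at
  most \<open>sqrt(h H)\<close> with \<open>H = near_min_bound m\<close>: one summand bounds \<open>g(\<tau>)\<close>, the other the oscillation.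
\<close>

definition near_min_bound :: "nat \<Rightarrow> real" where
  "near_min_bound m = (sqrt (lam * real m) + K * sqrt (real m + L))\<^sup>2"

lemma lam_le_near_min_bound: "lam * real m \<le> near_min_bound m"
proof -
  have "lam * real m = (sqrt (lam * real m))\<^sup>2" using lam_ge_1 by simp
  also have "\<dots> \<le> near_min_bound m" unfolding near_min_bound_def
    using K_nonneg L_nonneg lam_ge_1 by (intro power_mono) auto
  finally show ?thesis .
qed

lemma tol_le:
  assumes "tau lam f n = 1 / 2 ^ t" "k \<le> t" "t \<le> m"
  shows "tol n \<le> sqrt (1 / 2 ^ k) * sqrt (lam * real m)"
proof -
  have "lam * real t * ln 2 / 2 ^ t \<le> lam * real m * 1 / 2 ^ k"
    using assms lam_ge_1 ln_2_less_1 by (intro frac_le mult_mono) auto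
  then show ?thesis unfolding assms(1) g_dyadic real_sqrt_mult[symmetric] by simp
qed

text \<open>
  The interval \<open>(c, d)\<close> next to the best point has \<open>\<rho> \<ge> 1/H\<close>, so the interval that is halved has
  \<open>\<rho> \<ge> 1/H\<close> as well. The product of its offsets is then at most \<open>h H\<close>, and one of them is at most
  \<open>sqrt(h H)\<close>. The current error adds at most \<open>2 sqrt(h H)\<close>.
\<close>

lemma split_near_min:
  assumes "2 \<le> n" "tau lam f n = 1 / 2 ^ t" "level_ok t" "t \<le> m"
    and ab: "splits lam f n a b" and k: "dyadic_pair k a b"
  shows "\<exists>w\<in>{a, b}. f w \<le> infimum + 3 * sqrt (near_min_bound m / 2 ^ k)"
proof -
  let ?H = "near_min_bound m"
  note S = S_facts[OF assms(1)]
  have m: "0 < real m" using assms by simp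
  have "0 < lam * real m" using m lam_ge_1 by simp
  then have H: "0 < ?H" "sqrt ?H = sqrt (lam * real m) + K * sqrt (real m + L)"
    using lam_le_near_min_bound[of m] K_nonneg L_nonneg
    by (linarith, simp add: near_min_bound_def)
  have "best n \<in> f ` S n" unfolding min_value_def using S by (intro Min_in) auto
  then obtain u where u: "u \<in> S n" "f u = best n" by auto
  obtain v where v: "adjacent (S n) u v \<or> adjacent (S n) v u" using adjacent_at[OF S u(1)] by blast
  then obtain c d where cd: "adjacent (S n) c d" "{c, d} = {u, v}" by blast
  obtain l where l: "dyadic_pair l c d" using adjacent_dyadic[OF assms(1) cd(1)] by blast
  have lt: "l \<le> t" using level_le_tau[OF assms(1) cd(1) l assms(2)] .
  let ?h = "sqrt (1 / 2 ^ l)"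
  have "u \<in> {c..d}" "v \<in> {c..d}" using cd unfolding adjacent_def doubleton_eq_iff by auto
  then have "f v - f u \<le> K * sqrt ((real m + L) / 2 ^ l)"
    using modulus_le[OF l, of v u m] lt assms by auto
  then have fv: "f v - f u \<le> ?h * (K * sqrt (real m + L))"
    by (simp add: real_sqrt_divide)
  have tol: "tol n \<le> ?h * sqrt (lam * real m)" using tol_le[OF assms(2) lt assms(4)] .
  have off: "0 < offset n c" if "c \<in> S n" for c
    using offset_ge[OF that] tol_pos[OF assms(1)] by simp
  have "offset n u \<le> ?h * sqrt ?H" "offset n v \<le> ?h * sqrt ?H"
    using u fv tol K_nonneg L_nonneg unfolding H(2) by (auto simp: distrib_left intro: order_trans)
  moreover have "u \<in> S n" "v \<in> S n" using u v unfolding adjacent_def by auto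
  ultimately have "offset n u * offset n v \<le> (?h * sqrt ?H) * (?h * sqrt ?H)"
    using off H(1) by (intro mult_mono) (auto intro: less_imp_le)
  also have "\<dots> = ?H / 2 ^ l" using H(1) by (simp add: real_sqrt_divide field_simps)
  finally have "offset n c * offset n d \<le> ?H / 2 ^ l"
    using cd(2) unfolding doubleton_eq_iff by (auto simp: mult.commute)
  moreover have "0 < offset n c * offset n d" using off cd unfolding adjacent_def by simp
  ultimately have "1 / ?H \<le> (1 / 2 ^ l) / (offset n c * offset n d)"
    using H by (subst inverse_le_div_iff) auto
  also have "\<dots> \<le> (1 / 2 ^ k) / (offset n a * offset n b)"
    using ab cd(1) unfolding splits_def rho_pair_offset
    by (metis dyadic_pair_length[OF l] dyadic_pair_length[OF k])
  finally have *: "1 / ?H \<le> (1 / 2 ^ k) / (offset n a * offset n b)" .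
  have ab': "a \<in> S n" "b \<in> S n" using ab unfolding splits_def adjacent_def by auto
  have prod: "offset n a * offset n b \<le> ?H / 2 ^ k"
    using * H off[OF ab'(1)] off[OF ab'(2)] by (subst (asm) inverse_le_div_iff) auto
  have "\<exists>w\<in>{a, b}. offset n w \<le> sqrt (?H / 2 ^ k)"
  proof (rule ccontr)
    assume "\<not> ?thesis"
    then have "sqrt (?H / 2 ^ k) * sqrt (?H / 2 ^ k) < offset n a * offset n b"
      using H(1) off[OF ab'(1)] off[OF ab'(2)] by (intro mult_strict_mono) auto
    then show False using prod H by simp
  qed
  then obtain w where w: "w \<in> {a, b}" "offset n w \<le> sqrt (?H / 2 ^ k)" by blast
  have "best n - infimum \<le> g lam (1 / 2 ^ (t - 1))" using error_le_twice_tau assms by blast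
  also have "\<dots> \<le> sqrt (4 * (?H / 2 ^ k))"
  proof -
    have kt: "k \<le> t" using level_le_tau[OF assms(1) _ k assms(2)] ab unfolding splits_def by blast
    obtain s where s: "t = Suc s" using assms by (cases t) auto
    have "lam * real s * ln 2 / 2 ^ s \<le> (lam * real m) * 1 / 2 ^ s"
      using assms lam_ge_1 ln_2_less_1 s by (intro divide_right_mono mult_mono) auto
    also have "\<dots> \<le> ?H / 2 ^ s" using lam_le_near_min_bound by (intro divide_right_mono) auto
    also have "\<dots> = 2 * ?H / 2 ^ t" using s by simp
    also have "\<dots> \<le> 2 * ?H / 2 ^ k" using kt H by (intro divide_left_mono) auto
    also have "\<dots> \<le> 4 * (?H / 2 ^ k)" using H by (simp add: field_simps)
    finally show ?thesis using s by (simp add: g_dyadic)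
  qed
  also have "\<dots> = 2 * sqrt (?H / 2 ^ k)" by (simp only: real_sqrt_mult) simp
  finally have "f w \<le> infimum + 3 * sqrt (?H / 2 ^ k)"
    using w tol_pos[OF assms(1)] by simp
  then show ?thesis using w by blast
qed

definition near_min :: "nat \<Rightarrow> nat \<Rightarrow> nat set" where
  "near_min m k = {j. j \<le> 2 ^ k \<and> f (real j / 2 ^ k) \<le> infimum + 3 * sqrt (near_min_bound m / 2 ^ k)}"

text \<open>
  The midpoint created by a step determines the step. It is described by its level \<open>k\<close>, the
  near-minimal endpoint \<open>w\<close> and the side of \<open>w\<close> on which it lies, which leaves two midpoints
  for each near-minimal point of each of the \<open>m\<close> levels.
\<close>

lemma number_of_splits_le:
  assumes "2 \<le> n0" and ok: "\<And>i t. n0 \<le> i \<Longrightarrow> i < n \<Longrightarrow> tau lam f i = 1 / 2 ^ t \<Longrightarrow> level_ok t"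
    and m: "1 / 2 ^ m < tau lam f n"
    and N: "\<And>k. k < m \<Longrightarrow> card (near_min m k) \<le> N"
  shows "n - n0 \<le> 2 * m * N"
proof -
  define mid where "mid k = (\<lambda>(j, \<sigma>). (real j + \<sigma> / 2) / 2 ^ k)" for k :: nat
  define T where "T k = mid k ` (near_min m k \<times> {1, -1})" for k
  have fin: "finite (near_min m k)" for k unfolding near_min_def by auto
  have "point lam f (Suc i) \<in> (\<Union>k<m. T k)" if i: "n0 \<le> i" "i < n" for i
  proof -
    have i2: "2 \<le> i" using i assms by simp
    obtain a b where ab: "splits lam f i a b" using splits_exists[OF i2] by blast
    obtain k where k: "dyadic_pair k a b" using adjacent_dyadic[OF i2] ab unfolding splits_def by metis
    obtain t where t: "tau lam f i = 1 / 2 ^ t" using tau_dyadic[OF i2] by blast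
    have "1 / 2 ^ m < tau lam f i" using m tau_antimono[OF i2, of n lam f] i by simp
    then have "(2::real) ^ t < 2 ^ m" unfolding t by (simp add: field_simps)
    then have tm: "t < m" by simp
    have "k \<le> t" using level_le_tau[OF i2 _ k t] ab unfolding splits_def by blast
    then have km: "k < m" using tm by simp
    from split_near_min[OF i2 t ok[OF i t] _ ab k, of m] tm
    obtain w where w: "w \<in> {a, b}" "f w \<le> infimum + 3 * sqrt (near_min_bound m / 2 ^ k)" by auto
    obtain j where j: "j < 2 ^ k" "a = real j / 2 ^ k" "b = real (Suc j) / 2 ^ k"
      using k unfolding dyadic_pair_def by blast
    have p: "point lam f (Suc i) = (a + b) / 2" using ab unfolding splits_def by blast
    have "point lam f (Suc i) \<in> T k"
    proof (cases "w = a")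
      case True
      then have "j \<in> near_min m k" using w j unfolding near_min_def by auto
      moreover have "(a + b) / 2 = mid k (j, 1)" unfolding mid_def j by (simp add: field_simps)
      ultimately show ?thesis unfolding T_def p by blast
    next
      case False
      then have "Suc j \<in> near_min m k" using w j unfolding near_min_def by auto
      moreover have "(a + b) / 2 = mid k (Suc j, -1)" unfolding mid_def j by (simp add: field_simps)
      ultimately show ?thesis unfolding T_def p by blast
    qed
    then show ?thesis using km by blast
  qed
  then have sub: "(\<lambda>i. point lam f (Suc i)) ` {n0..<n} \<subseteq> (\<Union>k<m. T k)"
    unfolding image_subset_iff by (metis atLeastLessThan_iff)
  have inj: "inj_on (\<lambda>i. point lam f (Suc i)) {n0..<n}"
  proof (cases "n0 < n")
    case True
    then have "distinct (points lam f n)" using distinct_points[of n lam f] assms(1) by linarith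
    then have "inj_on (point lam f) {0..n}"
      unfolding points_def distinct_map by (metis atLeastLessThanSuc_atLeastAtMost set_upt)
    then show ?thesis by (intro inj_onI) (auto dest!: inj_onD)
  qed simp
  have "n - n0 = card ((\<lambda>i. point lam f (Suc i)) ` {n0..<n})" using inj by (simp add: card_image)
  also have "\<dots> \<le> card (\<Union>k<m. T k)" using sub fin unfolding T_def by (intro card_mono) auto
  also have "\<dots> \<le> (\<Sum>k<m. card (T k))" by (intro card_UN_le) auto
  also have "\<dots> \<le> (\<Sum>k<m. 2 * N)"
  proof (intro sum_mono)
    fix k assume "k \<in> {..<m}"
    then have "card (near_min m k \<times> {1, -1::real}) \<le> 2 * N" using N[of k] by (simp add: card_cartesian_product)
    moreover have "card (T k) \<le> card (near_min m k \<times> {1, -1::real})"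
      unfolding T_def using fin by (intro card_image_le) auto
    ultimately show "card (T k) \<le> 2 * N" by simp
  qed
  finally show ?thesis by (simp add: mult.commute mult.left_commute)
qed

text \<open>
  After more than \<open>n/2\<close> steps the smallest gap is below \<open>2/n\<close>, so \<open>log n\<close> is at most a multiple of
  the level of that gap. This is where \<open>\<lambda>\<close> has to be large compared with \<open>q\<close>.
\<close>

lemma large_step_level_ok:
  fixes n :: nat
  assumes "3 \<le> i" "n < 2 * i" "tau lam f i = 1 / 2 ^ t"
    and L: "L \<le> q * ln (real n)" and "0 \<le> q" and lam: "2 * K\<^sup>2 * (1 + 3 * q) \<le> lam" and "1 \<le> n"
  shows "level_ok t"
proof -
  have i2: "2 \<le> i" using assms by simp
  have "real i * tau lam f i \<le> 1"
    using length_times_min_gap_le[OF distinct_points[OF i2], of lam f i] S_facts[OF i2] by simp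
  then have it: "real i \<le> 2 ^ t" using assms by (simp add: field_simps)
  have "2 \<le> t"
  proof (rule ccontr)
    assume "\<not> 2 \<le> t"
    then have "(2::real) ^ t \<le> 2 ^ 1" by (intro power_increasing) auto
    then show False using it assms by simp
  qed
  have "real n \<le> 2 * real i" using assms by linarith
  then have "real n \<le> 2 ^ Suc t" using it unfolding power_Suc by linarith
  then have "ln (real n) \<le> ln (2 ^ Suc t)" using assms by (subst ln_le_cancel_iff) auto
  also have "\<dots> = real (Suc t) * ln 2" by (simp add: ln_realpow del: power_Suc)
  also have "\<dots> \<le> real (Suc t) * 1" using ln_2_less_1 by (intro mult_left_mono) auto
  also have "\<dots> \<le> 3 * real (t - 1)" using \<open>2 \<le> t\<close> by (simp add: of_nat_diff)
  finally have "L \<le> q * (3 * real (t - 1))"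
    using L \<open>0 \<le> q\<close> by (meson mult_left_mono order_trans)
  then have "K\<^sup>2 * (real (t - 1) + L) \<le> K\<^sup>2 * (real (t - 1) + q * (3 * real (t - 1)))"
    by (intro mult_left_mono) auto
  also have "\<dots> = (2 * K\<^sup>2 * (1 + 3 * q)) * real (t - 1) * (1 / 2)" by (simp add: algebra_simps)
  also have "\<dots> \<le> lam * real (t - 1) * ln 2"
    using lam lam_ge_1 ln2_ge_two_thirds \<open>0 \<le> q\<close> by (intro mult_mono) auto
  finally show ?thesis using \<open>2 \<le> t\<close> by blast
qed

text \<open>
  Only the second half of the steps is counted, since for those the level of the smallest gap is
  comparable to \<open>log n\<close>. If there are few near-minimal points, these steps suffice to bring
  the smallest gap down to \<open>1/2\<^sup>m\<close>, and the error is then at most \<open>g\<close> of twice this gap.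
\<close>

theorem error_le:
  assumes n: "4 \<le> n" and L: "L \<le> q * ln (real n)" and q: "0 \<le> q" and lam: "2 * K\<^sup>2 * (1 + 3 * q) \<le> lam"
    and N: "\<And>k. k < m \<Longrightarrow> card (near_min m k) \<le> N" and m: "4 * r * log 2 n \<le> real m"
    and large: "4 * m * N + 2 < n"
  shows "minimization_error lam n f \<le> 4 * sqrt lam * real n powr (- r)"
proof -
  define n0 where "n0 = n div 2 + 1"
  have ok: "level_ok t" if "n0 \<le> i" "i \<le> n" "tau lam f i = 1 / 2 ^ t" for i t
  proof -
    have "3 \<le> i" "n < 2 * i" "1 \<le> n" using that n unfolding n0_def by linarith+
    then show ?thesis using large_step_level_ok[OF _ _ that(3) L q lam] by metis
  qed
  have "\<not> 1 / 2 ^ m < tau lam f n"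
  proof
    assume "1 / 2 ^ m < tau lam f n"
    then have "n - n0 \<le> 2 * m * N"
      using n N ok by (intro number_of_splits_le) (auto simp: n0_def)
    then show False using large n unfolding n0_def by linarith
  qed
  moreover have n2: "2 \<le> n" using n by simp
  then obtain t where t: "tau lam f n = 1 / 2 ^ t" using tau_dyadic[OF n2] by blast
  ultimately have "(2::real) ^ m \<le> 2 ^ t" by (simp add: field_simps not_less)
  then have mt: "m \<le> t" by simp
  have okt: "level_ok t" using ok[OF _ _ t] n unfolding n0_def by simp
  define s where "s = t - 1"
  have s: "t = Suc s" using okt unfolding s_def by simp
  have "minimization_error lam n f = best n - infimum"
    by (simp add: minimization_error_def points_def)
  also have "\<dots> \<le> g lam (1 / 2 ^ s)" using error_le_twice_tau[OF n2 t okt] s by simp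
  also have "\<dots> = sqrt (lam * real s * ln 2 / 2 ^ s)" by (rule g_dyadic)
  also have "\<dots> \<le> sqrt ((4 * sqrt lam * real n powr (- r))\<^sup>2)"
  proof (rule real_sqrt_le_mono)
    \<comment> \<open>Half of the exponential factor is spent on absorbing the factor s.\<close>
    have "real s \<le> 4 * (1 + real s * ln 2 / 2)"
      using mult_left_mono[OF ln2_ge_two_thirds, of "real s"] by simp
    also have "\<dots> \<le> 4 * exp (real s * ln 2 / 2)" using exp_ge_add_one_self by (intro mult_left_mono) auto
    also have "\<dots> = 4 * 2 powr (real s / 2)" by (simp add: powr_def)
    finally have "lam * real s \<le> lam * (4 * 2 powr (real s / 2))"
      using lam_ge_1 by (intro mult_left_mono) auto
    then have "lam * real s * ln 2 \<le> lam * (4 * 2 powr (real s / 2)) * 1"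
      using lam_ge_1 ln_2_less_1 by (intro mult_mono) auto
    then have "lam * real s * ln 2 / 2 ^ s \<le> lam * (4 * 2 powr (real s / 2)) * 1 / 2 powr real s"
      by (simp add: powr_realpow divide_right_mono)
    also have "\<dots> = 4 * lam * 2 powr (- (real s / 2))"
      by (simp add: powr_minus field_simps powr_add[symmetric])
    also have "\<dots> \<le> 4 * lam * 2 powr (1 - real m / 2)"
      using mt s lam_ge_1 by (intro mult_left_mono powr_mono) auto
    also have "\<dots> \<le> 4 * lam * 2 powr (1 - 2 * r * log 2 n)"
      using m lam_ge_1 by (intro mult_left_mono powr_mono) auto
    also have "\<dots> = 8 * lam * real n powr (- 2 * r)"
    proof -
      have "2 powr (1 - 2 * r * log 2 n) = 2 powr 1 * (2 powr log 2 n) powr (- 2 * r)"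
        by (simp only: powr_powr powr_add[symmetric]) (simp add: algebra_simps)
      then show ?thesis using n by simp
    qed
    also have "\<dots> \<le> 16 * lam * real n powr (- 2 * r)" using lam_ge_1 by (intro mult_right_mono) auto
    also have "\<dots> = (4 * sqrt lam * real n powr (- r))\<^sup>2"
    proof -
      have "(real n powr (- r))\<^sup>2 = real n powr (- 2 * r)"
        unfolding power2_eq_square powr_add[symmetric] by simp
      then show ?thesis using lam_ge_1 by (simp add: power_mult_distrib)
    qed
    finally show "lam * real s * ln 2 / 2 ^ s \<le> (4 * sqrt lam * real n powr (- r))\<^sup>2" .
  qed
  also have "\<dots> = 4 * sqrt lam * real n powr (- r)" using lam_ge_1 by simp
  finally show ?thesis .
qed

end

section \<open>Chaining over dyadic increments\<close>

text \<open>
  Dyadic approximations from below, used both for chaining and to replace the infimum over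
  the unit interval by one over a countable set.
\<close>

lemma floor_dyadic_tendsto:
  fixes t :: real
  assumes "0 \<le> t"
  shows "(\<lambda>l. real (nat \<lfloor>t * 2 ^ l\<rfloor>) / 2 ^ l) \<longlonglongrightarrow> t"
proof (rule tendsto_sandwich)
  have floor: "real (nat \<lfloor>t * 2 ^ l\<rfloor>) \<le> t * 2 ^ l" "t * 2 ^ l \<le> real (nat \<lfloor>t * 2 ^ l\<rfloor>) + 1" for l
  proof -
    have "real (nat \<lfloor>t * 2 ^ l\<rfloor>) = of_int \<lfloor>t * 2 ^ l\<rfloor>" using assms by simp
    then show "real (nat \<lfloor>t * 2 ^ l\<rfloor>) \<le> t * 2 ^ l" "t * 2 ^ l \<le> real (nat \<lfloor>t * 2 ^ l\<rfloor>) + 1"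
      by linarith+
  qed
  show "\<forall>\<^sub>F l in sequentially. t - (1 / 2) ^ l \<le> real (nat \<lfloor>t * 2 ^ l\<rfloor>) / 2 ^ l"
  proof (intro always_eventually allI)
    fix l
    have "(t * 2 ^ l - 1) / 2 ^ l \<le> real (nat \<lfloor>t * 2 ^ l\<rfloor>) / 2 ^ l"
      using floor(2)[of l] by (intro divide_right_mono) auto
    then show "t - (1 / 2) ^ l \<le> real (nat \<lfloor>t * 2 ^ l\<rfloor>) / 2 ^ l"
      by (simp add: diff_divide_distrib power_one_over)
  qed
  show "\<forall>\<^sub>F l in sequentially. real (nat \<lfloor>t * 2 ^ l\<rfloor>) / 2 ^ l \<le> t"
    using floor by (intro always_eventually allI) (simp add: field_simps)
  have "(\<lambda>l. (1 / 2 :: real) ^ l) \<longlonglongrightarrow> 0" by (rule LIMSEQ_realpow_zero) auto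
  then have "(\<lambda>l. t - (1 / 2 :: real) ^ l) \<longlonglongrightarrow> t - 0"
    by (rule tendsto_diff[OF tendsto_const])
  then show "(\<lambda>l. t - (1 / 2) ^ l) \<longlonglongrightarrow> t" by simp
qed simp

lemma floor_dyadic_in_unit:
  fixes t :: real
  assumes "t \<in> {0..1}"
  shows "real (nat \<lfloor>t * 2 ^ l\<rfloor>) / 2 ^ l \<in> {0..1::real}"
proof -
  have "real (nat \<lfloor>t * 2 ^ l\<rfloor>) \<le> t * 2 ^ l" using assms by simp
  also have "\<dots> \<le> 1 * 2 ^ l" using assms by (intro mult_right_mono) auto
  finally show ?thesis by simp
qed

definition small_increments :: "(real \<Rightarrow> real) \<Rightarrow> real \<Rightarrow> bool" where
  "small_increments f L \<longleftrightarrow> (\<forall>k. \<forall>j<2 ^ k.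
    \<bar>f (real (Suc j) / 2 ^ k) - f (real j / 2 ^ k)\<bar> \<le> 2 * sqrt ((real k + L) / 2 ^ k))"

lemma sqrt_linear_geometric_le: "sqrt (real (i + 1) / 2 ^ i) \<le> 3 / 2 * (9 / 10) ^ i"
proof (rule real_le_lsqrt)
  have "1 + real i * (62 / 100) \<le> (1 + 62 / 100) ^ i" using Bernoulli_inequality[of "62/100" i] by simp
  then have "real (i + 1) \<le> 9 / 4 * (162 / 100) ^ i" by simp
  also have "(162 / 100 :: real) ^ i = 2 ^ i * (81 / 100) ^ i" by (simp add: power_mult_distrib[symmetric])
  finally have "real (i + 1) / 2 ^ i \<le> 9 / 4 * (81 / 100) ^ i" by (simp add: field_simps)
  also have "(81 / 100 :: real) ^ i = (9 / 10) ^ i * (9 / 10) ^ i"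
    unfolding power_mult_distrib[symmetric] by simp
  finally show "real (i + 1) / 2 ^ i \<le> (3 / 2 * (9 / 10) ^ i)\<^sup>2" by (simp add: power_mult_distrib power2_eq_square)
qed simp

text \<open>
  The dyadic approximations of \<open>s\<close> move by at most one increment of level \<open>l + 1\<close> from level \<open>l\<close> to
  the next. These increments decay geometrically relative to the one on level \<open>k\<close>, because \<open>k + i + L\<close>
  exceeds \<open>k + L\<close> by at most the factor \<open>i + 1\<close>.
\<close>

lemma chaining:
  assumes cont: "continuous_on {0..1} f" and L: "1 \<le> L" and incr: "small_increments f L"
    and j: "j < 2 ^ k" and s: "real j / 2 ^ k \<le> s" "s < real (Suc j) / 2 ^ k"
  shows "\<bar>f s - f (real j / 2 ^ k)\<bar> \<le> 30 * sqrt ((real k + L) / 2 ^ k)"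
proof -
  define w where "w = sqrt ((real k + L) / 2 ^ k)"
  define N where "N l = nat \<lfloor>s * 2 ^ l\<rfloor>" for l :: nat
  define d where "d l = real (N l) / 2 ^ l" for l
  have w: "0 \<le> w" unfolding w_def using L by simp
  have s0: "0 \<le> s" using s(1) by (meson divide_nonneg_pos of_nat_0_le_iff order_trans zero_less_numeral zero_less_power)
  have "real (Suc j) \<le> 2 ^ k" using j by (metis Suc_leI of_nat_le_iff of_nat_numeral of_nat_power)
  then have "real (Suc j) / 2 ^ k \<le> 1" by simp
  then have s1: "s < 1" using s by linarith
  have N_real: "real (N l) = of_int \<lfloor>s * 2 ^ l\<rfloor>" for l unfolding N_def using s0 by simp
  have N_bounds: "real (N l) \<le> s * 2 ^ l" "s * 2 ^ l < real (N l) + 1" for l unfolding N_real by linarith+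
  have dk: "d k = real j / 2 ^ k"
  proof -
    have "real j \<le> s * 2 ^ k" "s * 2 ^ k < real j + 1" using s by (auto simp: field_simps)
    then have "\<lfloor>s * 2 ^ k\<rfloor> = int j" by (simp add: floor_eq_iff)
    then show ?thesis unfolding d_def N_def by simp
  qed
  have step: "\<bar>f (d (Suc l)) - f (d l)\<bar> \<le> 2 * sqrt ((real (Suc l) + L) / 2 ^ Suc l)" for l
  proof -
    have "2 * N l \<le> N (Suc l)" "N (Suc l) \<le> 2 * N l + 1"
      using N_bounds[of l] N_bounds[of "Suc l"] by (auto simp: algebra_simps)
    then consider "N (Suc l) = 2 * N l" | "N (Suc l) = Suc (2 * N l)" by linarith
    then show ?thesis
    proof cases
      case 1
      then have "d (Suc l) = d l" unfolding d_def by simp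
      then show ?thesis using L by simp
    next
      case 2
      have "s * 2 ^ l < 1 * 2 ^ l" by (intro mult_strict_right_mono s1) simp
      then have "real (N l) < 2 ^ l" using N_bounds(1)[of l] by linarith
      then have "N l < 2 ^ l" by (metis of_nat_less_iff of_nat_numeral of_nat_power)
      then have "2 * N l < 2 ^ Suc l" by simp
      then have "\<bar>f (real (Suc (2 * N l)) / 2 ^ Suc l) - f (real (2 * N l) / 2 ^ Suc l)\<bar>
          \<le> 2 * sqrt ((real (Suc l) + L) / 2 ^ Suc l)"
        using incr unfolding small_increments_def by blast
      moreover have "real (2 * N l) / 2 ^ Suc l = d l" unfolding d_def by simp
      moreover have "real (Suc (2 * N l)) / 2 ^ Suc l = d (Suc l)" unfolding d_def 2 ..
      ultimately show ?thesis by simp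
    qed
  qed
  have scale: "2 * sqrt ((real (k + i) + L) / 2 ^ (k + i)) \<le> w * (3 * (9 / 10) ^ i)" for i
  proof -
    have "real i * 1 \<le> real i * (real k + L)" using L by (intro mult_left_mono) auto
    then have "(real (k + i) + L) \<le> (real k + L) * real (i + 1)" by (simp add: algebra_simps)
    then have "(real (k + i) + L) / 2 ^ (k + i) \<le> (real k + L) * real (i + 1) / 2 ^ (k + i)"
      by (intro divide_right_mono) auto
    also have "\<dots> = (real k + L) / 2 ^ k * (real (i + 1) / 2 ^ i)" by (simp add: power_add)
    finally have "sqrt ((real (k + i) + L) / 2 ^ (k + i)) \<le> w * sqrt (real (i + 1) / 2 ^ i)"
      unfolding w_def real_sqrt_mult[symmetric] by (rule real_sqrt_le_mono)
    also have "\<dots> \<le> w * (3 / 2 * (9 / 10) ^ i)"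
      by (intro mult_left_mono sqrt_linear_geometric_le w)
    finally show ?thesis by simp
  qed
  have bound: "\<bar>f (d (k + i)) - f (d k)\<bar> \<le> 30 * w * (1 - (9 / 10) ^ i)" for i
  proof (induction i)
    case (Suc i)
    have "\<bar>f (d (k + Suc i)) - f (d (k + i))\<bar> \<le> 2 * sqrt ((real (k + Suc i) + L) / 2 ^ (k + Suc i))"
      using step[of "k + i"] by simp
    also have "\<dots> \<le> w * (3 * (9 / 10) ^ Suc i)" by (rule scale)
    also have "\<dots> \<le> w * (3 * (9 / 10) ^ i)" using w by (intro mult_left_mono) auto
    finally show ?case using Suc by (simp add: algebra_simps)
  qed simp
  have bound': "\<bar>f (d (k + i)) - f (d k)\<bar> \<le> 30 * w" for i
  proof -
    have "30 * w * (1 - (9 / 10) ^ i) \<le> 30 * w * 1" using w by (intro mult_left_mono) auto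
    then show ?thesis using bound[of i] by linarith
  qed
  have s_in: "s \<in> {0..1}" using s0 s1 by simp
  have "d \<longlonglongrightarrow> s" using floor_dyadic_tendsto[OF s0] unfolding d_def N_def .
  then have "(\<lambda>i. d (i + k)) \<longlonglongrightarrow> s" by (rule LIMSEQ_ignore_initial_segment)
  then have "(\<lambda>i. f (d (i + k))) \<longlonglongrightarrow> f s"
    using floor_dyadic_in_unit[OF s_in] s_in unfolding d_def N_def
    by (intro continuous_on_tendsto_compose[OF cont]) auto
  then have "(\<lambda>i. \<bar>f (d (i + k)) - f (d k)\<bar>) \<longlonglongrightarrow> \<bar>f s - f (d k)\<bar>" by (intro tendsto_intros)
  then have "\<bar>f s - f (d k)\<bar> \<le> 30 * w"
    by (rule LIMSEQ_le_const2) (use bound' in \<open>auto simp: add.commute\<close>)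
  then show ?thesis unfolding dk w_def .
qed

lemma dyadic_modulus_of_small_increments:
  assumes cont: "continuous_on {0..1} f" and L: "1 \<le> L" and incr: "small_increments f L"
  shows "dyadic_modulus f 60 L"
  unfolding dyadic_modulus_def
proof (intro allI impI ballI)
  fix k a b s t assume ab: "dyadic_pair k a b" and s: "s \<in> {a..b}" and t: "t \<in> {a..b}"
  obtain j where j: "j < 2 ^ k" "a = real j / 2 ^ k" "b = real (Suc j) / 2 ^ k"
    using ab unfolding dyadic_pair_def by blast
  let ?w = "sqrt ((real k + L) / 2 ^ k)"
  have "\<bar>f u - f a\<bar> \<le> 30 * ?w" if u: "u \<in> {a..b}" for u
  proof (cases "u = b")
    case True
    have "\<bar>f b - f a\<bar> \<le> 2 * ?w" using incr j unfolding small_increments_def by blast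
    also have "\<dots> \<le> 30 * ?w" using L by (intro mult_right_mono) auto
    finally show ?thesis using True by simp
  next
    case False
    then show ?thesis using chaining[OF cont L incr j(1), of u] u j by auto
  qed
  from this[OF s] this[OF t] show "\<bar>f s - f t\<bar> \<le> 60 * ?w" by linarith
qed

section \<open>Measurability of the error\<close>

lemma split_index_in:
  assumes "2 \<le> length ts"
  shows "split_index lam f ts \<in> {1..<length ts}"
proof -
  let ?I = "{1..<length ts}"
  have "Max (rho lam f ts ` ?I) \<in> rho lam f ts ` ?I" using assms by (intro Max_in) auto
  then have "\<exists>j. j \<in> ?I \<and> rho lam f ts j = Max (rho lam f ts ` ?I)" by auto
  from LeastI_ex[OF this] show ?thesis unfolding split_index_def by blast
qed

locale continuous_process =
  fixes M :: "'a measure" and W :: "real \<Rightarrow> 'a \<Rightarrow> real"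
  assumes W_measurable: "\<And>t. t \<in> {0..1} \<Longrightarrow> W t \<in> borel_measurable M"
    and W_continuous: "\<And>\<omega>. \<omega> \<in> space M \<Longrightarrow> continuous_on {0..1} (\<lambda>t. W t \<omega>)"
begin

abbreviation path :: "'a \<Rightarrow> real \<Rightarrow> real" where
  "path \<omega> \<equiv> (\<lambda>t. W t \<omega>)"

text \<open>
  Finite lists of rationals form a countable set, so a quantity that depends on the random points
  is measurable as soon as it is for each fixed list. The length is at least 2 because only
  then is there a gap to choose.
\<close>

definition grids :: "real list set" where
  "grids = {ts \<in> lists (\<rat> \<inter> {0..1}). 2 \<le> length ts}"

lemma countable_grids: "countable grids"
  unfolding grids_def
  by (rule countable_subset[of _ "lists (\<rat> \<inter> {0..1})"])
    (auto intro: countable_subset[OF _ countable_rat])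

lemma grids_nth: "ts \<in> grids \<Longrightarrow> i < length ts \<Longrightarrow> sort ts ! i \<in> \<rat> \<inter> {0..1}"
proof -
  assume "ts \<in> grids" "i < length ts"
  then have "sort ts ! i \<in> set (sort ts)" "set ts \<subseteq> \<rat> \<inter> {0..1}"
    unfolding grids_def by (auto intro!: nth_mem simp del: set_sort)
  then show ?thesis by auto
qed

lemma min_value_measurable: "ts \<in> grids \<Longrightarrow> (\<lambda>\<omega>. min_value (path \<omega>) ts) \<in> borel_measurable M"
  unfolding min_value_def grids_def by (intro borel_measurable_Min W_measurable) auto

lemma rho_measurable:
  assumes "ts \<in> grids" "i \<in> {1..<length ts}"
  shows "(\<lambda>\<omega>. rho lam (path \<omega>) ts i) \<in> borel_measurable M"
proof -
  have [measurable]: "W (sort ts ! (i - 1)) \<in> borel_measurable M" "W (sort ts ! i) \<in> borel_measurable M"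
    using assms grids_nth[OF assms(1), of i] grids_nth[OF assms(1), of "i - 1"] by (auto intro!: W_measurable)
  have [measurable]: "(\<lambda>\<omega>. min_value (path \<omega>) ts) \<in> borel_measurable M"
    using min_value_measurable assms by blast
  show ?thesis unfolding rho_def by measurable
qed

lemma split_index_measurable:
  assumes "ts \<in> grids"
  shows "(\<lambda>\<omega>. split_index lam (path \<omega>) ts) \<in> measurable M (count_space UNIV)"
proof -
  let ?I = "{1..<length ts}"
  define P where "P j \<omega> \<longleftrightarrow> j \<in> ?I \<and> rho lam (path \<omega>) ts j = Max (rho lam (path \<omega>) ts ` ?I)" for j \<omega>
  have [measurable]: "(\<lambda>\<omega>. Max (rho lam (path \<omega>) ts ` ?I)) \<in> borel_measurable M"
    using rho_measurable[OF assms] by (intro borel_measurable_Max) auto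
  have "Measurable.pred M (P j)" for j
  proof (cases "j \<in> ?I")
    case True
    then have [measurable]: "(\<lambda>\<omega>. rho lam (path \<omega>) ts j) \<in> borel_measurable M"
      using rho_measurable[OF assms] by blast
    show ?thesis unfolding P_def by measurable
  next
    case False
    then have "P j = (\<lambda>\<omega>. False)" unfolding P_def by (intro ext) auto
    then show ?thesis by simp
  qed
  then have "(\<lambda>\<omega>. LEAST j. P j \<omega>) \<in> measurable M (count_space UNIV)"
    by (rule measurable_Least)
  then show ?thesis unfolding split_index_def P_def .
qed

lemma next_grid_measurable:
  assumes "ts \<in> grids"
  shows "(\<lambda>\<omega>. ts @ [next_point lam (path \<omega>) ts]) \<in> measurable M (count_space grids)"
proof -
  let ?F = "\<lambda>j. ts @ [(sort ts ! (j - 1) + sort ts ! j) / 2]"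
  have "(\<lambda>\<omega>. ?F (split_index lam (path \<omega>) ts)) \<in> measurable M (count_space UNIV)"
    using split_index_measurable[OF assms] by (rule measurable_compose) simp
  then have meas: "(\<lambda>\<omega>. ts @ [next_point lam (path \<omega>) ts]) \<in> measurable M (count_space UNIV)"
    unfolding next_point_def .
  have "ts @ [next_point lam (path \<omega>) ts] \<in> grids" for \<omega>
  proof -
    let ?j = "split_index lam (path \<omega>) ts"
    have j: "?j \<in> {1..<length ts}" using assms by (intro split_index_in) (simp add: grids_def)
    have "sort ts ! (?j - 1) \<in> \<rat> \<inter> {0..1}" "sort ts ! ?j \<in> \<rat> \<inter> {0..1}"
      using j by (auto intro!: grids_nth[OF assms, THEN IntD1] simp: grids_nth[OF assms, THEN IntD2, simplified])
    then have "next_point lam (path \<omega>) ts \<in> \<rat> \<inter> {0..1}" unfolding next_point_def by auto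
    then show ?thesis using assms unfolding grids_def by auto
  qed
  then show ?thesis using meas unfolding measurable_count_space_eq_countable[OF countable_grids]
    by (auto intro: measurable_sets)
qed

lemma points_measurable:
  assumes "1 \<le> n"
  shows "(\<lambda>\<omega>. points lam (path \<omega>) n) \<in> measurable M (count_space grids)"
  using assms
proof (induction n rule: dec_induct)
  case base
  have "points lam f 1 = [0, 1]" for f unfolding points_def by simp
  moreover have "[0, 1] \<in> grids" unfolding grids_def by auto
  ultimately show ?case by (simp only:) (rule measurable_const, simp)
next
  case (step n)
  show ?case
  proof (cases "n = 1")
    case True
    have "points lam f (Suc n) = [0, 1, 1 / 2]" for f
      using points_2 unfolding True by (metis Suc_1)
    moreover have "[0, 1, 1 / 2] \<in> grids" unfolding grids_def by auto
    ultimately show ?thesis by (simp only:) (rule measurable_const, simp)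
  next
    case False
    then have "2 \<le> n" using step by linarith
    then have eq: "points lam f (Suc n) = points lam f n @ [next_point lam f (points lam f n)]" for f
      unfolding points_Suc by (simp only: point_Suc)
    show ?thesis unfolding eq
      by (rule measurable_compose_countable'[OF next_grid_measurable step.IH countable_grids])
  qed
qed

lemma infimum_over_rationals:
  assumes "\<omega> \<in> space M"
  shows "(INF t\<in>{0..1}. W t \<omega>) = (INF t\<in>\<rat> \<inter> {0..1}. W t \<omega>)"
proof (rule antisym)
  have "compact (path \<omega> ` {0..1})" using W_continuous[OF assms] by (intro compact_continuous_image) auto
  then have bdd: "bdd_below (path \<omega> ` {0..1})" by (simp add: bounded_imp_bdd_below compact_imp_bounded)
  then have bdd': "bdd_below (path \<omega> ` (\<rat> \<inter> {0..1}))" by (rule bdd_below_mono) auto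
  show "(INF t\<in>{0..1}. W t \<omega>) \<le> (INF t\<in>\<rat> \<inter> {0..1}. W t \<omega>)"
  proof (rule cINF_superset_mono[OF _ bdd])
    have "(0 :: real) \<in> \<rat> \<inter> {0..1}" by simp
    then show "\<rat> \<inter> {0..1::real} \<noteq> {}" by blast
  qed simp_all
  show "(INF t\<in>\<rat> \<inter> {0..1}. W t \<omega>) \<le> (INF t\<in>{0..1}. W t \<omega>)"
  proof (rule cINF_greatest)
    fix t :: real assume t: "t \<in> {0..1}"
    let ?d = "\<lambda>l. real (nat \<lfloor>t * 2 ^ l\<rfloor>) / 2 ^ l"
    have d: "?d l \<in> {0..1}" for l by (rule floor_dyadic_in_unit[OF t])
    have "(\<lambda>l. W (?d l) \<omega>) \<longlonglongrightarrow> W t \<omega>"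
      using t d floor_dyadic_tendsto[of t] by (intro continuous_on_tendsto_compose[OF W_continuous[OF assms]]) auto
    moreover have "(INF t\<in>\<rat> \<inter> {0..1}. W t \<omega>) \<le> W (?d l) \<omega>" for l
      using d[of l] by (intro cINF_lower[OF bdd']) auto
    ultimately show "(INF t\<in>\<rat> \<inter> {0..1}. W t \<omega>) \<le> W t \<omega>" by (intro LIMSEQ_le_const) auto
  qed simp
qed

theorem minimization_error_measurable:
  assumes "1 \<le> n"
  shows "(\<lambda>\<omega>. minimization_error lam n (path \<omega>)) \<in> borel_measurable M"
proof -
  have [measurable]: "(\<lambda>\<omega>. min_value (path \<omega>) (points lam (path \<omega>) n)) \<in> borel_measurable M"
    by (rule measurable_compose_countable'[OF min_value_measurable points_measurable[OF assms] countable_grids])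
  have "countable (\<rat> \<inter> {0..1::real})" using countable_rat by (rule countable_subset[rotated]) auto
  then have "(\<lambda>\<omega>. INF t\<in>\<rat> \<inter> {0..1}. W t \<omega>) \<in> borel_measurable M"
    using W_measurable by (intro borel_measurable_cINF_real) auto
  then have [measurable]: "(\<lambda>\<omega>. INF t\<in>{0..1}. W t \<omega>) \<in> borel_measurable M"
    by (subst measurable_cong[OF infimum_over_rationals])
  show ?thesis unfolding minimization_error_def points_def[symmetric] by measurable
qed

end

section \<open>Gaussian tails and independence of disjoint blocks\<close>

text \<open>
  For \<open>x \<ge> y \<ge> 0\<close> we have \<open>x\<^sup>2 \<ge> y\<^sup>2 + (x - y)\<^sup>2\<close>, so beyond \<open>y\<close> the density is at most
  \<open>exp(-y\<^sup>2 / 2s\<^sup>2)\<close> times the density centred at \<open>y\<close>.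
\<close>

lemma prob_normal_ge_le:
  assumes "prob_space M" "distributed M lborel X (normal_density 0 s)" "0 < s" "0 \<le> y"
  shows "measure M {\<omega>\<in>space M. y \<le> X \<omega>} \<le> exp (- y\<^sup>2 / (2 * s\<^sup>2))"
proof -
  interpret prob_space M by fact
  have "emeasure M (X -` {y..} \<inter> space M) =
      (\<integral>\<^sup>+x. ennreal (normal_density 0 s x) * indicator {y..} x \<partial>lborel)"
    using distributed_emeasure[OF assms(2), of "{y..}"] by simp
  also have "\<dots> \<le> (\<integral>\<^sup>+x. ennreal (exp (- y\<^sup>2 / (2 * s\<^sup>2))) * ennreal (normal_density y s x) \<partial>lborel)"
  proof (intro nn_integral_mono)
    fix x :: real
    have "- x\<^sup>2 / (2 * s\<^sup>2) \<le> - y\<^sup>2 / (2 * s\<^sup>2) - (x - y)\<^sup>2 / (2 * s\<^sup>2)" if "y \<le> x"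
    proof -
      have "0 \<le> y * (x - y)" using that assms by simp
      then have "- x\<^sup>2 \<le> - y\<^sup>2 - (x - y)\<^sup>2" by (simp add: power2_eq_square algebra_simps)
      then show ?thesis unfolding diff_divide_distrib[symmetric] by (intro divide_right_mono) auto
    qed
    then have "normal_density 0 s x \<le> exp (- y\<^sup>2 / (2 * s\<^sup>2)) * normal_density y s x" if "y \<le> x"
      using that unfolding normal_density_def
      by (simp add: mult_ac exp_add[symmetric] divide_right_mono)
    then show "ennreal (normal_density 0 s x) * indicator {y..} x
        \<le> ennreal (exp (- y\<^sup>2 / (2 * s\<^sup>2))) * ennreal (normal_density y s x)"
      by (auto simp: indicator_def ennreal_mult[symmetric] intro!: ennreal_leI)
  qed
  also have "\<dots> = ennreal (exp (- y\<^sup>2 / (2 * s\<^sup>2)))"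
    using prob_space.emeasure_space_1[OF prob_space_normal_density[OF assms(3), of y]]
    by (simp add: nn_integral_cmult emeasure_density)
  finally have "emeasure M (X -` {y..} \<inter> space M) \<le> ennreal (exp (- y\<^sup>2 / (2 * s\<^sup>2)))" .
  moreover have "X -` {y..} \<inter> space M = {\<omega>\<in>space M. y \<le> X \<omega>}" by auto
  ultimately show ?thesis by (simp add: emeasure_eq_measure)
qed

lemma distributed_normal_uminus:
  assumes "prob_space M" "distributed M lborel X (normal_density 0 s)" "0 < s"
  shows "distributed M lborel (\<lambda>\<omega>. - X \<omega>) (normal_density 0 s)"
  using prob_space.normal_density_affine[OF assms, of "-1" 0] by simp

lemma prob_normal_abs_gt_le:
  assumes "prob_space M" "distributed M lborel X (normal_density 0 s)" "0 < s" "0 \<le> y"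
  shows "measure M {\<omega>\<in>space M. y < \<bar>X \<omega>\<bar>} \<le> 2 * exp (- y\<^sup>2 / (2 * s\<^sup>2))"
proof -
  interpret prob_space M by fact
  have [measurable]: "random_variable borel X" using distributed_measurable[OF assms(2)] by simp
  have "prob {\<omega>\<in>space M. y < \<bar>X \<omega>\<bar>} \<le> prob ({\<omega>\<in>space M. y \<le> X \<omega>} \<union> {\<omega>\<in>space M. y \<le> - X \<omega>})"
    by (intro finite_measure_mono) auto
  also have "\<dots> \<le> prob {\<omega>\<in>space M. y \<le> X \<omega>} + prob {\<omega>\<in>space M. y \<le> - X \<omega>}"
    by (intro measure_Un_le) auto
  also have "\<dots> \<le> exp (- y\<^sup>2 / (2 * s\<^sup>2)) + exp (- y\<^sup>2 / (2 * s\<^sup>2))"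
    using assms by (intro add_mono prob_normal_ge_le distributed_normal_uminus)
  finally show ?thesis by simp
qed

lemma prob_normal_abs_le_le:
  assumes "prob_space M" "distributed M lborel X (normal_density 0 s)" "0 < s" "0 \<le> y"
  shows "measure M {\<omega>\<in>space M. \<bar>X \<omega>\<bar> \<le> y} \<le> y / s"
proof -
  interpret prob_space M by fact
  have "emeasure M (X -` {-y..y} \<inter> space M) =
      (\<integral>\<^sup>+x. ennreal (normal_density 0 s x) * indicator {-y..y} x \<partial>lborel)"
    using distributed_emeasure[OF assms(2), of "{-y..y}"] by simp
  also have "\<dots> \<le> (\<integral>\<^sup>+x. ennreal (1 / (2 * s)) * indicator {-y..y} x \<partial>lborel)"
  proof (intro nn_integral_mono mult_right_mono ennreal_leI)
    fix x :: real
    have "4 \<le> 2 * pi" using pi_gt3 by simp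
    then have "2 * s \<le> sqrt (2 * pi * s\<^sup>2)"
      using assms by (intro real_le_rsqrt) (auto simp: power2_eq_square intro!: mult_right_mono)
    moreover have "exp (- (x - 0)\<^sup>2 / (2 * s\<^sup>2)) \<le> 1" by simp
    ultimately have "1 / sqrt (2 * pi * s\<^sup>2) * exp (- (x - 0)\<^sup>2 / (2 * s\<^sup>2)) \<le> 1 / (2 * s) * 1"
      using assms by (intro mult_mono divide_left_mono) auto
    then show "normal_density 0 s x \<le> 1 / (2 * s)" unfolding normal_density_def by simp
  qed simp
  also have "\<dots> = ennreal (y / s)"
    using assms by (simp add: nn_integral_cmult_indicator ennreal_mult[symmetric])
  finally have "emeasure M (X -` {-y..y} \<inter> space M) \<le> ennreal (y / s)" .
  moreover have "X -` {-y..y} \<inter> space M = {\<omega>\<in>space M. \<bar>X \<omega>\<bar> \<le> y}" by auto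
  ultimately show ?thesis using assms by (simp add: emeasure_eq_measure)
qed

lemma prob_normal_neg_eq:
  assumes "prob_space M" "distributed M lborel X (normal_density 0 s)" "0 < s" "0 \<le> y"
  shows "2 * measure M {\<omega>\<in>space M. X \<omega> < - y} = 1 - measure M {\<omega>\<in>space M. \<bar>X \<omega>\<bar> \<le> y}"
proof -
  interpret prob_space M by fact
  have [measurable]: "random_variable borel X" using distributed_measurable[OF assms(2)] by simp
  have sym: "prob {\<omega>\<in>space M. - X \<omega> < - y} = prob {\<omega>\<in>space M. X \<omega> < - y}"
  proof -
    have eq: "distr M lborel X = distr M lborel (\<lambda>\<omega>. - X \<omega>)"
      using assms(2) distributed_normal_uminus[OF assms(1-3)] unfolding distributed_def by simp
    have "measure (distr M lborel X) {..< - y} = measure (distr M lborel (\<lambda>\<omega>. - X \<omega>)) {..< - y}"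
      using eq by simp
    then show ?thesis by (simp add: measure_distr vimage_def Int_def conj_commute)
  qed
  have "prob {\<omega>\<in>space M. X \<omega> < - y} + prob {\<omega>\<in>space M. - X \<omega> < - y} =
    prob ({\<omega>\<in>space M. X \<omega> < - y} \<union> {\<omega>\<in>space M. - X \<omega> < - y})"
    using assms(4) by (intro finite_measure_Union[symmetric]) auto
  also have "\<dots> = prob (space M - {\<omega>\<in>space M. \<bar>X \<omega>\<bar> \<le> y})"
    using assms(4) by (intro arg_cong[where f=prob]) auto
  also have "\<dots> = 1 - prob {\<omega>\<in>space M. \<bar>X \<omega>\<bar> \<le> y}" by (intro prob_compl) simp
  finally show ?thesis using sym by simp
qed

text \<open>
  The events are described by predicates on the whole sequence, so that the same predicate can be
  used for different index sets; it has to ignore all entries outside its index set.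
\<close>

lemma (in prob_space) prob_indep_disjoint_indices:
  fixes X :: "nat \<Rightarrow> 'a \<Rightarrow> real"
  assumes ind: "indep_vars (\<lambda>_. borel) X I" and AB: "A \<inter> B = {}" "A \<subseteq> I" "B \<subseteq> I"
    and P: "Measurable.pred (PiM A (\<lambda>_. borel)) P" and Q: "Measurable.pred (PiM B (\<lambda>_. borel)) Q"
    and P': "\<And>z. P (restrict z A) = P z" and Q': "\<And>z. Q (restrict z B) = Q z"
  shows "prob {\<omega>\<in>space M. P (\<lambda>i. X i \<omega>) \<and> Q (\<lambda>i. X i \<omega>)} =
    prob {\<omega>\<in>space M. P (\<lambda>i. X i \<omega>)} * prob {\<omega>\<in>space M. Q (\<lambda>i. X i \<omega>)}"
proof -
  let ?f = "\<lambda>A \<omega>. restrict (\<lambda>i. X i \<omega>) A"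
  have iv: "indep_var (PiM A (\<lambda>_. borel)) (?f A) (PiM B (\<lambda>_. borel)) (?f B)"
    using indep_var_restrict[OF ind AB] by simp
  let ?PA = "{z\<in>space (PiM A (\<lambda>_. borel)). P z}" and ?QB = "{z\<in>space (PiM B (\<lambda>_. borel)). Q z}"
  have s: "?PA \<in> sets (PiM A (\<lambda>_. borel))" "?QB \<in> sets (PiM B (\<lambda>_. borel))" using P Q by simp_all
  have "prob ((\<lambda>\<omega>. (?f A \<omega>, ?f B \<omega>)) -` (?PA \<times> ?QB) \<inter> space M) =
      prob (?f A -` ?PA \<inter> space M) * prob (?f B -` ?QB \<inter> space M)"
    by (rule indep_varD[OF iv s])
  moreover have "(\<lambda>\<omega>. (?f A \<omega>, ?f B \<omega>)) -` (?PA \<times> ?QB) \<inter> space M =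
      {\<omega>\<in>space M. P (\<lambda>i. X i \<omega>) \<and> Q (\<lambda>i. X i \<omega>)}"
    by (auto simp: P' Q' space_PiM)
  moreover have "?f A -` ?PA \<inter> space M = {\<omega>\<in>space M. P (\<lambda>i. X i \<omega>)}" by (auto simp: P' space_PiM)
  moreover have "?f B -` ?QB \<inter> space M = {\<omega>\<in>space M. Q (\<lambda>i. X i \<omega>)}" by (auto simp: Q' space_PiM)
  ultimately show ?thesis by simp
qed

section \<open>How long a Gaussian walk stays above a level\<close>

lemma (in prob_space) indep_vars_reindex_scale:
  fixes X :: "nat \<Rightarrow> 'a \<Rightarrow> real"
  assumes "indep_vars (\<lambda>_. borel) X I" "inj_on h J" "h ` J \<subseteq> I"
  shows "indep_vars (\<lambda>_. borel) (\<lambda>j \<omega>. c * X (h j) \<omega>) J"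
proof -
  have "indep_vars (\<lambda>j. PiM {h j} (\<lambda>_. borel)) (\<lambda>j \<omega>. restrict (\<lambda>i. X i \<omega>) {h j}) J"
    using assms by (intro indep_vars_restrict[OF assms(1)]) (auto simp: disjoint_family_on_def inj_on_def)
  from indep_vars_compose2[OF this, where Y="\<lambda>j f. c * f (h j)" and N="\<lambda>_. borel"]
  show ?thesis by simp
qed

text \<open>
  A discrete reflection principle. Split according to the first time \<open>i\<close> at which the walk is below
  \<open>-x\<close>. If no increment exceeds \<open>D\<close>, the walk is then still above \<open>-x - D\<close>, so to end below
  \<open>-x - D\<close> it has to go down after time \<open>i\<close>, which has conditional probability at most one half. Hence,
  up to the probability of a large increment, leaving \<open>[-x, \<infinity>)\<close> is at least twice as likely as
  ending below \<open>-x - D\<close>, so that by symmetry staying is at most as likely as ending in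
  \<open>[-x - D, x + D]\<close>.
\<close>

lemma (in prob_space) walk_stays_above:
  fixes X :: "nat \<Rightarrow> 'a \<Rightarrow> real"
  assumes ind: "indep_vars (\<lambda>_. borel) X {..<u}"
    and nor: "\<And>i. i < u \<Longrightarrow> distributed M lborel (X i) (normal_density 0 s)"
    and s: "0 < s" and x: "0 \<le> x" and D: "0 \<le> D" and u: "1 \<le> u"
  shows "prob {\<omega>\<in>space M. \<forall>i\<in>{..u}. - x \<le> (\<Sum>l<i. X l \<omega>)}
    \<le> (x + D) / (s * sqrt u) + 4 * real u * exp (- D\<^sup>2 / (2 * s\<^sup>2))"
proof -
  define S where "S i \<omega> = (\<Sum>l<i. X l \<omega>)" for i \<omega>
  have X[measurable]: "random_variable borel (X i)" if "i < u" for i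
    using distributed_measurable[OF nor[OF that]] by simp
  have S[measurable]: "random_variable borel (S i)" if "i \<le> u" for i
    unfolding S_def using that by (intro borel_measurable_sum X) auto
  have sum_normal: "distributed M lborel (\<lambda>\<omega>. \<Sum>l\<in>{i..<u}. X l \<omega>) (normal_density 0 (s * sqrt (u - i)))"
    if "i < u" for i
  proof -
    have "distributed M lborel (\<lambda>\<omega>. \<Sum>l\<in>{i..<u}. X l \<omega>)
      (normal_density (\<Sum>l\<in>{i..<u}. 0) (sqrt (\<Sum>l\<in>{i..<u}. s\<^sup>2)))"
      using that s by (intro sum_indep_normal indep_vars_subset[OF ind] nor) auto
    then show ?thesis using s by (simp add: real_sqrt_mult mult.commute)
  qed
  define T where "T = {\<omega>\<in>space M. \<forall>i\<in>{..u}. - x \<le> S i \<omega>}"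
  define A where "A i = {\<omega>\<in>space M. S i \<omega> < - x \<and> (\<forall>j\<in>{..<i}. - x \<le> S j \<omega>)}" for i
  define C where "C i = {\<omega>\<in>space M. (S i \<omega> < - x \<and> (\<forall>j\<in>{..<i}. - x \<le> S j \<omega>)) \<and> (\<Sum>l\<in>{i..<u}. X l \<omega>) < 0}" for i
  define B where "B i = {\<omega>\<in>space M. D < \<bar>X i \<omega>\<bar>}" for i
  define E where "E = {\<omega>\<in>space M. S u \<omega> < - (x + D)}"
  have A_ev: "A i \<in> events" if "i \<le> u" for i
    unfolding A_def using that by (intro sets.sets_Collect_conj sets.sets_Collect_finite_All
        borel_measurable_less borel_measurable_le S) auto
  have C_ev: "C i \<in> events" if "i \<le> u" for i
    unfolding C_def using that by (intro sets.sets_Collect_conj sets.sets_Collect_finite_All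
        borel_measurable_less borel_measurable_le S borel_measurable_sum X) auto
  have B_ev: "B i \<in> events" if "i < u" for i unfolding B_def using X[OF that] by measurable
  have E_ev: "E \<in> events" unfolding E_def using S[of u] by measurable
  have T_ev: "T \<in> events" unfolding T_def
    by (intro sets.sets_Collect_finite_All borel_measurable_le S) auto
  have half: "prob (C i) \<le> prob (A i) / 2" if i: "i \<le> u" for i
  proof (cases "i = u")
    case True
    then have "C i = {}" unfolding C_def by simp
    then show ?thesis by simp
  next
    case False
    then have iu: "i < u" using i by simp
    let ?P = "\<lambda>z::nat\<Rightarrow>real. (\<Sum>l<i. z l) < - x \<and> (\<forall>j\<in>{..<i}. - x \<le> (\<Sum>l<j. z l))"
    let ?Q = "\<lambda>z::nat\<Rightarrow>real. (\<Sum>l\<in>{i..<u}. z l) < 0"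
    have "prob {\<omega>\<in>space M. ?P (\<lambda>i. X i \<omega>) \<and> ?Q (\<lambda>i. X i \<omega>)} =
      prob {\<omega>\<in>space M. ?P (\<lambda>i. X i \<omega>)} * prob {\<omega>\<in>space M. ?Q (\<lambda>i. X i \<omega>)}"
    proof (rule prob_indep_disjoint_indices[OF ind, where A="{..<i}" and B="{i..<u}"])
      show "Measurable.pred (PiM {..<i} (\<lambda>_. borel)) ?P"
        unfolding pred_def
        by (intro sets.sets_Collect_conj sets.sets_Collect_finite_All borel_measurable_less
            borel_measurable_le borel_measurable_sum measurable_component_singleton) auto
      show "Measurable.pred (PiM {i..<u} (\<lambda>_. borel)) ?Q"
        unfolding pred_def
        by (intro borel_measurable_less borel_measurable_sum measurable_component_singleton) auto
    qed (use iu in \<open>auto intro!: sum.cong\<close>)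
    then have "prob (C i) = prob (A i) * prob {\<omega>\<in>space M. (\<Sum>l\<in>{i..<u}. X l \<omega>) < 0}"
      unfolding C_def A_def S_def .
    moreover have "2 * prob {\<omega>\<in>space M. (\<Sum>l\<in>{i..<u}. X l \<omega>) < - 0} \<le> 1"
      using iu s by (subst prob_normal_neg_eq[OF prob_space_axioms sum_normal[OF iu]]) auto
    ultimately show ?thesis using mult_left_mono[of _ "1/2" "prob (A i)"] by simp
  qed
  have E_sub: "E \<subseteq> (\<Union>i<u. B i) \<union> (\<Union>i\<le>u. C i)"
  proof
    fix \<omega> assume w: "\<omega> \<in> E"
    show "\<omega> \<in> (\<Union>i<u. B i) \<union> (\<Union>i\<le>u. C i)"
    proof (cases "\<exists>i<u. D < \<bar>X i \<omega>\<bar>")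
      case True
      then show ?thesis using w unfolding B_def E_def by auto
    next
      case False
      have ex: "S u \<omega> < - x" using w D unfolding E_def by simp
      define i where "i = (LEAST i. S i \<omega> < - x)"
      have i: "S i \<omega> < - x" unfolding i_def by (rule LeastI[where P="\<lambda>i. S i \<omega> < - x", OF ex])
      have iu: "i \<le> u" unfolding i_def by (rule Least_le[where P="\<lambda>i. S i \<omega> < - x", OF ex])
      have before: "- x \<le> S j \<omega>" if "j < i" for j
        using not_less_Least[where P="\<lambda>i. S i \<omega> < - x", OF that[unfolded i_def]] by simp
      have "i \<noteq> 0" using i x unfolding S_def by (intro notI) simp
      then obtain k where k: "i = Suc k" by (cases i) auto
      have "- x \<le> S k \<omega>" using before[of k] k by simp
      moreover have "\<bar>X k \<omega>\<bar> \<le> D" using False k iu by (metis Suc_le_lessD not_less)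
      ultimately have "- (x + D) \<le> S i \<omega>" unfolding k S_def by simp
      moreover have "S u \<omega> = S i \<omega> + (\<Sum>l\<in>{i..<u}. X l \<omega>)"
        unfolding S_def using iu by (simp add: sum.atLeastLessThan_concat lessThan_atLeast0)
      ultimately have "(\<Sum>l\<in>{i..<u}. X l \<omega>) < 0" using w unfolding E_def by simp
      then have "\<omega> \<in> C i" using i before w unfolding C_def E_def by auto
      then show ?thesis using iu by auto
    qed
  qed
  have B_le: "prob (B i) \<le> 2 * exp (- D\<^sup>2 / (2 * s\<^sup>2))" if "i < u" for i
    unfolding B_def by (rule prob_normal_abs_gt_le[OF prob_space_axioms nor[OF that] s D])
  have "prob E \<le> prob ((\<Union>i<u. B i) \<union> (\<Union>i\<le>u. C i))"
    using E_sub B_ev C_ev by (intro finite_measure_mono) auto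
  also have "\<dots> \<le> prob (\<Union>i<u. B i) + prob (\<Union>i\<le>u. C i)"
    using B_ev C_ev by (intro measure_Un_le) auto
  also have "\<dots> \<le> (\<Sum>i<u. prob (B i)) + (\<Sum>i\<le>u. prob (C i))"
    using B_ev C_ev by (intro add_mono measure_UNION_le) auto
  also have "\<dots> \<le> (\<Sum>i<u. 2 * exp (- D\<^sup>2 / (2 * s\<^sup>2))) + (\<Sum>i\<le>u. prob (A i) / 2)"
    using B_le half by (intro add_mono sum_mono) auto
  also have "(\<Sum>i\<le>u. prob (A i) / 2) = prob (\<Union>i\<le>u. A i) / 2"
  proof -
    have "disjoint_family_on A {..u}"
    proof (unfold disjoint_family_on_def, intro ballI impI)
      fix i j :: nat assume "i \<noteq> j"
      then show "A i \<inter> A j = {}" unfolding A_def by (cases i j rule: linorder_cases) force+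
    qed
    then show ?thesis unfolding sum_divide_distrib[symmetric]
      using A_ev by (subst finite_measure_finite_Union) auto
  qed
  also have "prob (\<Union>i\<le>u. A i) \<le> prob (space M - T)"
  proof (intro finite_measure_mono)
    show "(\<Union>i\<le>u. A i) \<subseteq> space M - T" unfolding A_def T_def by (auto simp: not_le[symmetric])
  qed (use T_ev in auto)
  also have "prob (space M - T) = 1 - prob T" using T_ev by (rule prob_compl)
  finally have "prob E \<le> real u * (2 * exp (- D\<^sup>2 / (2 * s\<^sup>2))) + (1 - prob T) / 2" by simp
  moreover have "a \<le> u * (2 * e) + (1 - t) / 2 \<Longrightarrow> 2 * a \<le> 4 * u * e + (1 - t)" for a u e t :: real
    by (simp add: field_simps)
  ultimately have E_le: "2 * prob E \<le> 4 * real u * exp (- D\<^sup>2 / (2 * s\<^sup>2)) + (1 - prob T)"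
    by blast
  have Su: "distributed M lborel (S u) (normal_density 0 (s * sqrt u))"
    using sum_normal[of 0] u unfolding S_def[abs_def] by (simp add: lessThan_atLeast0)
  have pos: "0 < s * sqrt u" "0 \<le> x + D" using s u x D by auto
  have "1 - (x + D) / (s * sqrt u) \<le> 2 * prob E"
    unfolding E_def prob_normal_neg_eq[OF prob_space_axioms Su pos]
    using prob_normal_abs_le_le[OF prob_space_axioms Su pos] by simp
  then show ?thesis using E_le unfolding T_def S_def by linarith
qed

section \<open>How many points of a Gaussian walk lie near its minimum\<close>

text \<open>
  The entries of \<open>z\<close> are increments. Walking forwards from \<open>a\<close> and backwards from \<open>b\<close>, each for half
  the gap, uses disjoint sets of increments. The factors \<open>1\<close> and \<open>-1\<close> keep both halves in the form
  in which the estimate for a walk is applied.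
\<close>

definition gap_ok :: "real \<Rightarrow> (nat \<Rightarrow> real) \<Rightarrow> nat \<Rightarrow> nat \<Rightarrow> bool" where
  "gap_ok x z a b \<longleftrightarrow>
    (\<forall>i\<in>{..(b - a) div 2}. - x \<le> (\<Sum>l<i. 1 * z (a + l))) \<and>
    (\<forall>i\<in>{..(b - a) div 2}. - x \<le> (\<Sum>l<i. - 1 * z (b - 1 - l)))"

fun chain_ok :: "real \<Rightarrow> (nat \<Rightarrow> real) \<Rightarrow> nat list \<Rightarrow> bool" where
  "chain_ok x z (a # b # js) \<longleftrightarrow> gap_ok x z a b \<and> chain_ok x z (b # js)"
| "chain_ok x z js \<longleftrightarrow> True"

fun chain_weight :: "real \<Rightarrow> nat list \<Rightarrow> real" where
  "chain_weight c (a # b # js) = c / real (b - a) * chain_weight c (b # js)"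
| "chain_weight c js = 1"

definition increasing_lists :: "nat \<Rightarrow> nat \<Rightarrow> nat list set" where
  "increasing_lists R Q = {js. length js = Q \<and> sorted_wrt (<) js \<and> set js \<subseteq> {..R}}"

lemma finite_increasing_lists: "finite (increasing_lists R Q)"
proof -
  have "finite {js. set js \<subseteq> {..R} \<and> length js = Q}" by (intro finite_lists_length_eq) simp
  then show ?thesis by (rule finite_subset[rotated]) (auto simp: increasing_lists_def)
qed

lemma chain_weight_nonneg: "0 \<le> c \<Longrightarrow> 0 \<le> chain_weight c js"
  by (induction c js rule: chain_weight.induct) auto

lemma chain_weight_Cons:
  "js \<noteq> [] \<Longrightarrow> chain_weight c (a # js) = c / real (hd js - a) * chain_weight c js"
  by (cases js) auto

lemma sum_inverse_distance: "(\<Sum>a<b. 1 / real (b - a)) = (harm b :: real)"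
proof -
  have "(\<Sum>a<b. 1 / real (b - a)) = (\<Sum>a<b. 1 / real (Suc a))"
    by (subst sum.nat_diff_reindex[symmetric]) (intro sum.cong, auto)
  then show ?thesis by (simp add: harm_altdef inverse_eq_divide)
qed

text \<open>
  Summing over the first entry, with the rest of the list fixed, contributes a harmonic number for
  each gap. Only the last entry is summed without a weight, whence the single factor \<open>R + 1\<close>.
\<close>

lemma sum_chain_weight_le:
  assumes "0 \<le> c"
  shows "(\<Sum>js\<in>increasing_lists R (Suc Q). chain_weight c js) \<le> real (R + 1) * (c * harm R) ^ Q"
proof (induction Q)
  case 0
  have "increasing_lists R (Suc 0) = (\<lambda>j. [j]) ` {..R}" unfolding increasing_lists_def by (auto simp: length_Suc_conv)
  then show ?case by (simp add: sum.reindex inj_on_def)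
next
  case (Suc Q)
  let ?T = "Sigma (increasing_lists R (Suc Q)) (\<lambda>js. {..<hd js})"
  have ne: "js \<noteq> []" if "js \<in> increasing_lists R (Suc Q)" for js using that unfolding increasing_lists_def by auto
  have eq: "increasing_lists R (Suc (Suc Q)) = (\<lambda>(js, a). a # js) ` ?T"
  proof (intro equalityI subsetI)
    fix js assume "js \<in> increasing_lists R (Suc (Suc Q))"
    then obtain a ks where "js = a # ks" "length ks = Suc Q" "sorted_wrt (<) (a # ks)" "set (a # ks) \<subseteq> {..R}"
      unfolding increasing_lists_def by (auto simp: length_Suc_conv)
    then show "js \<in> (\<lambda>(js, a). a # js) ` ?T"
      by (intro image_eqI[of _ _ "(ks, a)"]) (auto simp: increasing_lists_def length_Suc_conv)
  next
    fix js assume "js \<in> (\<lambda>(js, a). a # js) ` ?T"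
    then obtain a ks where ks: "js = a # ks" "ks \<in> increasing_lists R (Suc Q)" "a < hd ks" by auto
    then obtain b ls where "ks = b # ls" using ne by (cases ks) auto
    then show "js \<in> increasing_lists R (Suc (Suc Q))" using ks unfolding increasing_lists_def by fastforce
  qed
  have "(\<Sum>js\<in>increasing_lists R (Suc (Suc Q)). chain_weight c js) =
      (\<Sum>(js, a)\<in>?T. chain_weight c (a # js))"
    unfolding eq by (subst sum.reindex) (auto simp: inj_on_def intro!: sum.cong)
  also have "\<dots> = (\<Sum>js\<in>increasing_lists R (Suc Q). \<Sum>a<hd js. chain_weight c (a # js))"
    by (subst sum.Sigma) (auto simp: finite_increasing_lists)
  also have "\<dots> = (\<Sum>js\<in>increasing_lists R (Suc Q). chain_weight c js * (c * harm (hd js)))"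
  proof (intro sum.cong refl)
    fix js assume "js \<in> increasing_lists R (Suc Q)"
    then have "(\<Sum>a<hd js. chain_weight c (a # js)) = (\<Sum>a<hd js. chain_weight c js * c * (1 / real (hd js - a)))"
      using ne by (intro sum.cong) (auto simp: chain_weight_Cons)
    then show "(\<Sum>a<hd js. chain_weight c (a # js)) = chain_weight c js * (c * harm (hd js))"
      unfolding sum_distrib_left[symmetric] sum_inverse_distance by (simp add: mult.assoc)
  qed
  also have "\<dots> \<le> (\<Sum>js\<in>increasing_lists R (Suc Q). chain_weight c js * (c * harm R))"
  proof (intro sum_mono mult_left_mono)
    fix js assume js: "js \<in> increasing_lists R (Suc Q)"
    then have "hd js \<in> set js" using ne by simp
    then have "hd js \<le> R" using js unfolding increasing_lists_def by auto
    then show "harm (hd js) \<le> (harm R :: real)" by (rule harm_mono)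
  qed (use assms chain_weight_nonneg in auto)
  also have "\<dots> = (\<Sum>js\<in>increasing_lists R (Suc Q). chain_weight c js) * (c * harm R)"
    by (simp add: sum_distrib_right)
  also have "\<dots> \<le> (real (R + 1) * (c * harm R) ^ Q) * (c * harm R)"
    using Suc assms by (intro mult_right_mono mult_nonneg_nonneg harm_nonneg)
  finally show ?case by (simp add: mult_ac)
qed

lemma card_choose_le_increasing_lists:
  assumes "J \<subseteq> {..R}"
  shows "card J choose Q \<le> card {js\<in>increasing_lists R Q. set js \<subseteq> J}"
proof -
  have fin: "finite J" using assms finite_subset by blast
  have "{B. B \<subseteq> J \<and> card B = Q} \<subseteq> set ` {js\<in>increasing_lists R Q. set js \<subseteq> J}"
  proof
    fix B assume "B \<in> {B. B \<subseteq> J \<and> card B = Q}"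
    then have B: "B \<subseteq> J" "card B = Q" "finite B" using fin finite_subset by auto
    then show "B \<in> set ` {js\<in>increasing_lists R Q. set js \<subseteq> J}"
      using assms by (intro image_eqI[of _ _ "sorted_list_of_set B"]) (auto simp: increasing_lists_def)
  qed
  then have "card {B. B \<subseteq> J \<and> card B = Q} \<le> card (set ` {js\<in>increasing_lists R Q. set js \<subseteq> J})"
    using finite_increasing_lists by (intro card_mono) auto
  also have "\<dots> \<le> card {js\<in>increasing_lists R Q. set js \<subseteq> J}" using finite_increasing_lists by (intro card_image_le) auto
  finally show ?thesis using n_subsets[OF fin] by simp
qed

lemma gap_ok_restrict:
  assumes "a < b" "{a..<b} \<subseteq> A"
  shows "gap_ok x (restrict z A) a b = gap_ok x z a b"
proof -
  have "a + l \<in> A" "b - 1 - l \<in> A" if "l < i" "i \<le> (b - a) div 2" for l i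
  proof -
    have "a + l \<in> {a..<b}" "b - 1 - l \<in> {a..<b}" using that assms(1) by auto
    then show "a + l \<in> A" "b - 1 - l \<in> A" using assms(2) by blast+
  qed
  then have
    1: "(\<Sum>l<i. 1 * restrict z A (a + l)) = (\<Sum>l<i. 1 * z (a + l))" and
    2: "(\<Sum>l<i. - 1 * restrict z A (b - 1 - l)) = (\<Sum>l<i. - 1 * z (b - 1 - l))"
    if "i \<le> (b - a) div 2" for i
    using that by (auto intro!: sum.cong)
  show ?thesis unfolding gap_ok_def using 1 2 by auto
qed

lemma chain_ok_restrict:
  assumes "sorted_wrt (<) js" "\<And>j. j \<in> set js \<Longrightarrow> {j..<R} \<subseteq> A \<and> j \<le> R"
  shows "chain_ok x (restrict z A) js = chain_ok x z js"
  using assms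
proof (induction x z js rule: chain_ok.induct)
  case (1 x z a b js)
  have "{a..<b} \<subseteq> A" using 1(3)[of a] 1(3)[of b] by auto
  then have "gap_ok x (restrict z A) a b = gap_ok x z a b" using 1(2) by (intro gap_ok_restrict) auto
  moreover have "chain_ok x (restrict z A) (b # js) = chain_ok x z (b # js)"
    by (rule 1(1)) (use 1(2,3) in auto)
  ultimately show ?case by (simp only: chain_ok.simps)
qed auto

lemma pred_gap_ok:
  assumes "a < b" "{a..<b} \<subseteq> A"
  shows "Measurable.pred (PiM A (\<lambda>_. borel)) (\<lambda>z. gap_ok x z a b)"
  unfolding gap_ok_def pred_def using assms
  by (intro sets.sets_Collect_conj sets.sets_Collect_finite_All borel_measurable_le
      borel_measurable_sum borel_measurable_times measurable_component_singleton) auto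

lemma pred_chain_ok:
  assumes "sorted_wrt (<) js" "\<And>j. j \<in> set js \<Longrightarrow> {j..<R} \<subseteq> A \<and> j \<le> R"
  shows "Measurable.pred (PiM A (\<lambda>_. borel)) (\<lambda>z. chain_ok x z js)"
  using assms
proof (induction js rule: induct_list012)
  case (3 a b js)
  have "{a..<b} \<subseteq> A" using 3(4)[of a] 3(4)[of b] by auto
  then have "Measurable.pred (PiM A (\<lambda>_. borel)) (\<lambda>z. gap_ok x z a b)"
    using 3 by (intro pred_gap_ok) auto
  moreover have "Measurable.pred (PiM A (\<lambda>_. borel)) (\<lambda>z. chain_ok x z (b # js))" using 3 by auto
  ultimately show ?case by simp
qed auto

locale gaussian_walk = prob_space M for M :: "'a measure" +
  fixes X :: "nat \<Rightarrow> 'a \<Rightarrow> real" and R :: nat and s :: real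
  assumes indep: "indep_vars (\<lambda>_. borel) X {..<R}"
    and normal: "\<And>i. i < R \<Longrightarrow> distributed M lborel (X i) (normal_density 0 s)"
    and s_pos: "0 < s"
begin

definition walk :: "nat \<Rightarrow> 'a \<Rightarrow> real" where
  "walk j \<omega> = (\<Sum>l<j. X l \<omega>)"

text \<open>
  The summand \<open>2 sqrt(ln R)\<close> is the size, in units of \<open>s\<close>, above which increments among \<open>R\<close> are rare;
  the \<open>4\<close> covers their probability.
\<close>

definition barrier :: "real \<Rightarrow> real" where
  "barrier y = y + 2 * sqrt (ln R) + 4"

definition near_walk_min :: "real \<Rightarrow> 'a \<Rightarrow> nat set" where
  "near_walk_min y \<omega> = {j. j \<le> R \<and> (\<forall>i\<le>R. walk j \<omega> \<le> walk i \<omega> + y * s)}"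

lemma X_measurable: "i < R \<Longrightarrow> random_variable borel (X i)"
  using distributed_measurable[OF normal] by simp

lemma walk_measurable: "j \<le> R \<Longrightarrow> random_variable borel (walk j)"
  unfolding walk_def by (intro borel_measurable_sum X_measurable) auto

lemma stays_above_le:
  fixes u :: nat
  assumes h: "inj_on h {..<u}" "h ` {..<u} \<subseteq> {..<R}" and c: "c = 1 \<or> c = - 1"
    and u: "1 \<le> u" and y: "0 \<le> y"
  shows "prob {\<omega>\<in>space M. \<forall>i\<in>{..u}. - (y * s) \<le> (\<Sum>l<i. c * X (h l) \<omega>)} \<le> barrier y / sqrt (real u)"
proof -
  have uR: "u \<le> R" using card_inj_on_le[OF h] by simp
  define D where "D = 2 * s * sqrt (ln R)"
  have lnR: "0 \<le> ln R" using u uR by simp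
  have "prob {\<omega>\<in>space M. \<forall>i\<in>{..u}. - (y * s) \<le> (\<Sum>l<i. c * X (h l) \<omega>)}
    \<le> (y * s + D) / (s * sqrt (real u)) + 4 * real u * exp (- D\<^sup>2 / (2 * s\<^sup>2))"
  proof (rule walk_stays_above[OF _ _ s_pos _ _ u])
    show "indep_vars (\<lambda>_. borel) (\<lambda>l \<omega>. c * X (h l) \<omega>) {..<u}"
      by (rule indep_vars_reindex_scale[OF indep h])
    fix i assume "i < u"
    then have "h i < R" using h by auto
    then show "distributed M lborel (\<lambda>\<omega>. c * X (h i) \<omega>) (normal_density 0 s)"
      using c normal distributed_normal_uminus[OF prob_space_axioms normal s_pos] by auto
  qed (use y s_pos lnR in \<open>auto simp: D_def\<close>)
  also have "(y * s + D) / (s * sqrt (real u)) = (y + 2 * sqrt (ln R)) / sqrt (real u)"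
  proof -
    have "y * s + D = s * (y + 2 * sqrt (ln R))" unfolding D_def by (simp add: algebra_simps)
    then show ?thesis using s_pos by simp
  qed
  also have "4 * real u * exp (- D\<^sup>2 / (2 * s\<^sup>2)) \<le> 4 / sqrt (real u)"
  proof -
    have "- D\<^sup>2 / (2 * s\<^sup>2) = - ln (real R) + - ln (real R)"
      using s_pos lnR unfolding D_def by (simp add: power_mult_distrib)
    then have "exp (- D\<^sup>2 / (2 * s\<^sup>2)) = 1 / R * (1 / R)"
      using u uR by (simp only: exp_add) (simp add: exp_minus inverse_eq_divide)
    moreover have "sqrt u \<le> R"
    proof -
      have "sqrt u \<le> sqrt (real R * real R)"
        using u uR by (intro real_sqrt_le_mono) (metis mult_mono' le_square of_nat_0_le_iff of_nat_mono order_trans of_nat_mult)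
      then show ?thesis by simp
    qed
    then have "1 / real R \<le> 1 / sqrt (real u)" using u uR by (intro divide_left_mono) auto
    moreover have "u * (1 / real R) \<le> 1" using u uR by simp
    ultimately have "u * (1 / real R) * (1 / R) \<le> 1 * (1 / sqrt (real u))"
      by (intro mult_mono) auto
    then show ?thesis using \<open>exp (- D\<^sup>2 / (2 * s\<^sup>2)) = 1 / R * (1 / R)\<close> by simp
  qed
  finally show ?thesis by (simp add: barrier_def add_divide_distrib)
qed

lemma barrier_ge_1: "0 \<le> y \<Longrightarrow> 1 \<le> R \<Longrightarrow> 1 \<le> barrier y"
  unfolding barrier_def using real_sqrt_ge_zero[of "ln (real R)"] by simp

text \<open>
  The two halves of the gap are independent, and each contributes the inverse square root of its
  length. A gap of length 1 has empty halves; there the bound exceeds 1.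
\<close>

lemma prob_gap_ok_le:
  assumes "a < b" "b \<le> R" "0 \<le> y"
  shows "prob {\<omega>\<in>space M. gap_ok (y * s) (\<lambda>i. X i \<omega>) a b} \<le> 3 * (barrier y)\<^sup>2 / real (b - a)"
proof -
  let ?B = "barrier y" and ?u = "(b - a) div 2"
  have B: "1 \<le> ?B" using assms by (intro barrier_ge_1) auto
  show ?thesis
  proof (cases "?u = 0")
    case True
    then have "b - a = 1" using assms by linarith
    moreover have "1 \<le> ?B\<^sup>2" using B by (simp add: one_le_power)
    ultimately have "1 \<le> 3 * ?B\<^sup>2 / real (b - a)" by simp
    then show ?thesis by (rule order_trans[OF prob_le_1])
  next
    case False
    then have u: "1 \<le> ?u" by simp
    let ?P = "\<lambda>z::nat\<Rightarrow>real. \<forall>i\<in>{..?u}. - (y * s) \<le> (\<Sum>l<i. 1 * z (a + l))"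
    let ?Q = "\<lambda>z::nat\<Rightarrow>real. \<forall>i\<in>{..?u}. - (y * s) \<le> (\<Sum>l<i. - 1 * z (b - 1 - l))"
    have "prob {\<omega>\<in>space M. ?P (\<lambda>i. X i \<omega>) \<and> ?Q (\<lambda>i. X i \<omega>)} =
      prob {\<omega>\<in>space M. ?P (\<lambda>i. X i \<omega>)} * prob {\<omega>\<in>space M. ?Q (\<lambda>i. X i \<omega>)}"
    proof (rule prob_indep_disjoint_indices[OF indep, where A="{a..<a + ?u}" and B="{b - ?u..<b}"])
      show "Measurable.pred (PiM {a..<a + ?u} (\<lambda>_. borel)) ?P" unfolding pred_def using assms
        by (intro sets.sets_Collect_finite_All borel_measurable_le
            borel_measurable_sum borel_measurable_times measurable_component_singleton) auto
      show "Measurable.pred (PiM {b - ?u..<b} (\<lambda>_. borel)) ?Q" unfolding pred_def using assms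
        by (intro sets.sets_Collect_finite_All borel_measurable_le
            borel_measurable_sum borel_measurable_times measurable_component_singleton) auto
      show "{a..<a + ?u} \<inter> {b - ?u..<b} = {}" "{a..<a + ?u} \<subseteq> {..<R}" "{b - ?u..<b} \<subseteq> {..<R}"
        using assms by auto
      fix z :: "nat \<Rightarrow> real"
      have "(\<Sum>l<i. 1 * restrict z {a..<a + ?u} (a + l)) = (\<Sum>l<i. 1 * z (a + l))" if "i \<le> ?u" for i
        using that by (intro sum.cong) auto
      then show "?P (restrict z {a..<a + ?u}) = ?P z" by simp
      have "(\<Sum>l<i. - 1 * restrict z {b - ?u..<b} (b - 1 - l)) = (\<Sum>l<i. - 1 * z (b - 1 - l))" if "i \<le> ?u" for i
        using that assms by (intro sum.cong) auto
      then show "?Q (restrict z {b - ?u..<b}) = ?Q z" by simp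
    qed
    also have "\<dots> \<le> (?B / sqrt ?u) * (?B / sqrt ?u)"
    proof (intro mult_mono)
      show "prob {\<omega>\<in>space M. ?P (\<lambda>i. X i \<omega>)} \<le> ?B / sqrt ?u"
        using assms u by (intro stays_above_le[of "\<lambda>l. a + l"]) (auto simp: inj_on_def)
      show "prob {\<omega>\<in>space M. ?Q (\<lambda>i. X i \<omega>)} \<le> ?B / sqrt ?u"
        using assms u by (intro stays_above_le[of "\<lambda>l. b - 1 - l"]) (auto simp: inj_on_def)
    qed (use B in auto)
    also have "\<dots> = ?B\<^sup>2 / ?u" by (simp add: power2_eq_square)
    also have "\<dots> \<le> 3 * ?B\<^sup>2 / real (b - a)"
    proof -
      have "b - a \<le> 3 * ?u" using u by linarith
      then have "real (b - a) \<le> 3 * real ?u" by linarith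
      then have "?B\<^sup>2 * real (b - a) \<le> ?B\<^sup>2 * (3 * real ?u)" by (intro mult_left_mono) auto
      moreover have "0 < real ?u" "0 < real (b - a)" using u assms by auto
      ultimately show ?thesis by (simp add: field_simps)
    qed
    finally show ?thesis unfolding gap_ok_def .
  qed
qed

lemma chain_ok_event:
  assumes "sorted_wrt (<) js" "set js \<subseteq> {..R}"
  shows "{\<omega>\<in>space M. chain_ok x (\<lambda>i. X i \<omega>) js} \<in> events"
proof -
  have "Measurable.pred (PiM {..<R} (\<lambda>_. borel)) (\<lambda>z. chain_ok x z js)"
    using assms by (intro pred_chain_ok[where R=R]) auto
  moreover have "(\<lambda>\<omega>. restrict (\<lambda>i. X i \<omega>) {..<R}) \<in> measurable M (PiM {..<R} (\<lambda>_. borel))"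
    by (intro measurable_restrict X_measurable) auto
  ultimately have "Measurable.pred M (\<lambda>\<omega>. chain_ok x (restrict (\<lambda>i. X i \<omega>) {..<R}) js)"
    by (rule measurable_compose[rotated])
  moreover have "chain_ok x (restrict z {..<R}) js = chain_ok x z js" for z
    using assms by (intro chain_ok_restrict[where R=R]) auto
  ultimately show ?thesis by (simp add: pred_def)
qed

text \<open>
  The conditions on different gaps use increments from disjoint intervals of indices.
\<close>

lemma prob_chain_ok_le:
  assumes "sorted_wrt (<) js" "set js \<subseteq> {..R}" "0 \<le> y"
  shows "prob {\<omega>\<in>space M. chain_ok (y * s) (\<lambda>i. X i \<omega>) js} \<le> chain_weight (3 * (barrier y)\<^sup>2) js"
  using assms
proof (induction js rule: induct_list012)
  case (3 a b js)
  have ab: "a < b" "b \<le> R" using 3 by auto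
  have "prob {\<omega>\<in>space M. gap_ok (y * s) (\<lambda>i. X i \<omega>) a b \<and> chain_ok (y * s) (\<lambda>i. X i \<omega>) (b # js)} =
    prob {\<omega>\<in>space M. gap_ok (y * s) (\<lambda>i. X i \<omega>) a b} * prob {\<omega>\<in>space M. chain_ok (y * s) (\<lambda>i. X i \<omega>) (b # js)}"
  proof (rule prob_indep_disjoint_indices[OF indep, where A="{a..<b}" and B="{b..<R}"])
    show "Measurable.pred (PiM {a..<b} (\<lambda>_. borel)) (\<lambda>z. gap_ok (y * s) z a b)"
      using ab by (intro pred_gap_ok) auto
    have *: "sorted_wrt (<) (b # js)" "\<And>j. j \<in> set (b # js) \<Longrightarrow> {j..<R} \<subseteq> {b..<R} \<and> j \<le> R"
      using 3 by auto
    show "Measurable.pred (PiM {b..<R} (\<lambda>_. borel)) (\<lambda>z. chain_ok (y * s) z (b # js))"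
      by (rule pred_chain_ok[OF *])
    show "chain_ok (y * s) (restrict z {b..<R}) (b # js) = chain_ok (y * s) z (b # js)" for z
      by (rule chain_ok_restrict[OF *])
    show "gap_ok (y * s) (restrict z {a..<b}) a b = gap_ok (y * s) z a b" for z
      using ab by (intro gap_ok_restrict) auto
  qed (use ab in auto)
  also have "\<dots> \<le> (3 * (barrier y)\<^sup>2 / real (b - a)) * chain_weight (3 * (barrier y)\<^sup>2) (b # js)"
    using 3 ab prob_gap_ok_le[of a b y] by (intro mult_mono) auto
  finally show ?case by simp
qed auto

lemma walk_add: "walk (a + i) \<omega> = walk a \<omega> + (\<Sum>l<i. 1 * X (a + l) \<omega>)"
  unfolding walk_def by (induction i) auto

lemma walk_diff: "i \<le> b \<Longrightarrow> walk (b - i) \<omega> = walk b \<omega> + (\<Sum>l<i. - 1 * X (b - 1 - l) \<omega>)"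
proof (induction i)
  case (Suc i)
  have "b - i = Suc (b - 1 - i)" using Suc by simp
  then have "walk (b - i) \<omega> = walk (b - 1 - i) \<omega> + X (b - 1 - i) \<omega>" unfolding walk_def by simp
  moreover have "walk (b - Suc i) \<omega> = walk (b - 1 - i) \<omega>" by simp
  moreover have "walk (b - i) \<omega> = walk b \<omega> + (\<Sum>l<i. - 1 * X (b - 1 - l) \<omega>)" using Suc by simp
  ultimately show ?case unfolding sum.lessThan_Suc by linarith
qed simp

lemma chain_ok_near_min:
  assumes "sorted_wrt (<) js" "set js \<subseteq> near_walk_min y \<omega>"
  shows "chain_ok (y * s) (\<lambda>i. X i \<omega>) js"
  using assms
proof (induction js rule: induct_list012)
  case (3 a b js)
  have a: "a < b" "b \<le> R" "\<And>i. i \<le> R \<Longrightarrow> walk a \<omega> \<le> walk i \<omega> + y * s" "\<And>i. i \<le> R \<Longrightarrow> walk b \<omega> \<le> walk i \<omega> + y * s"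
    using 3 unfolding near_walk_min_def by auto
  have "gap_ok (y * s) (\<lambda>i. X i \<omega>) a b"
    unfolding gap_ok_def
  proof (intro conjI ballI)
    fix i assume i: "i \<in> {..(b - a) div 2}"
    show "- (y * s) \<le> (\<Sum>l<i. 1 * X (a + l) \<omega>)"
      using a(3)[of "a + i"] a(1,2) i unfolding walk_add by fastforce
    have "i \<le> b" using i a(1) by auto
    then show "- (y * s) \<le> (\<Sum>l<i. - 1 * X (b - 1 - l) \<omega>)"
      using a(4)[of "b - i"] a(1,2) i unfolding walk_diff[OF \<open>i \<le> b\<close>] by fastforce
  qed
  then show ?case using 3 by auto
qed auto

text \<open>
  Markov's inequality for the number of increasing lists of near-minimal points: \<open>N\<close> such points
  contain \<open>N choose Suc Q\<close> lists, while the expected number of lists is bounded by the sum of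
  the weights.
\<close>

theorem prob_many_near_min_le:
  assumes y: "0 \<le> y"
  shows "{\<omega>\<in>space M. N \<le> card (near_walk_min y \<omega>)} \<in> events"
    and "prob {\<omega>\<in>space M. N \<le> card (near_walk_min y \<omega>)} * real (N choose Suc Q)
      \<le> real (R + 1) * (3 * (barrier y)\<^sup>2 * harm R) ^ Q"
proof -
  let ?F = "{\<omega>\<in>space M. N \<le> card (near_walk_min y \<omega>)}" and ?c = "3 * (barrier y)\<^sup>2"
  have fin: "near_walk_min y \<omega> \<subseteq> {..R}" "finite (near_walk_min y \<omega>)" for \<omega>
  proof -
    show "near_walk_min y \<omega> \<subseteq> {..R}" unfolding near_walk_min_def by (rule subsetI) simp
    then show "finite (near_walk_min y \<omega>)" using finite_subset by blast
  qed
  have ev: "{\<omega>\<in>space M. \<forall>i\<in>{..R}. walk j \<omega> \<le> walk i \<omega> + y * s} \<in> events" if "j \<le> R" for j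
  proof (intro sets.sets_Collect_finite_All borel_measurable_le)
    show "random_variable borel (walk j)" using that by (rule walk_measurable)
    show "random_variable borel (\<lambda>\<omega>. walk i \<omega> + y * s)" if "i \<in> {..R}" for i
      using walk_measurable[of i] that by simp
  qed simp
  have "real (card (near_walk_min y \<omega>)) =
      (\<Sum>j\<le>R. indicator {\<omega>\<in>space M. \<forall>i\<in>{..R}. walk j \<omega> \<le> walk i \<omega> + y * s} \<omega>)" if "\<omega> \<in> space M" for \<omega>
  proof -
    have "near_walk_min y \<omega> = {j\<in>{..R}. \<omega> \<in> {\<omega>\<in>space M. \<forall>i\<in>{..R}. walk j \<omega> \<le> walk i \<omega> + y * s}}"
      using that unfolding near_walk_min_def by auto
    then show ?thesis by (simp add: indicator_def sum.If_cases Int_def)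
  qed
  then have "?F = {\<omega>\<in>space M. real N \<le>
      (\<Sum>j\<le>R. indicator {\<omega>\<in>space M. \<forall>i\<in>{..R}. walk j \<omega> \<le> walk i \<omega> + y * s} \<omega>)}"
    by (metis (mono_tags, lifting) of_nat_le_iff)
  also have "\<dots> \<in> events"
    using ev by (intro borel_measurable_le borel_measurable_sum borel_measurable_indicator) auto
  finally show F: "?F \<in> events" .
  have ok: "{\<omega>\<in>space M. chain_ok (y * s) (\<lambda>i. X i \<omega>) js} \<in> events" if "js \<in> increasing_lists R (Suc Q)" for js
    using that by (intro chain_ok_event) (auto simp: increasing_lists_def)
  have "prob ?F * real (N choose Suc Q) = expectation (\<lambda>\<omega>. real (N choose Suc Q) * indicator ?F \<omega>)"
    using F by simp
  also have "\<dots> \<le> expectation (\<lambda>\<omega>. \<Sum>js\<in>increasing_lists R (Suc Q). indicator {\<omega>\<in>space M. chain_ok (y * s) (\<lambda>i. X i \<omega>) js} \<omega>)"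
  proof (intro integral_mono)
    fix \<omega> assume w: "\<omega> \<in> space M"
    show "real (N choose Suc Q) * indicator ?F \<omega> \<le>
      (\<Sum>js\<in>increasing_lists R (Suc Q). indicator {\<omega>\<in>space M. chain_ok (y * s) (\<lambda>i. X i \<omega>) js} \<omega>)"
    proof (cases "\<omega> \<in> ?F")
      case True
      let ?J = "near_walk_min y \<omega>"
      have "N choose Suc Q \<le> card ?J choose Suc Q" using True by (intro binomial_right_mono) auto
      also have "\<dots> \<le> card {js\<in>increasing_lists R (Suc Q). set js \<subseteq> ?J}" using fin by (intro card_choose_le_increasing_lists) auto
      also have "\<dots> \<le> card {js\<in>increasing_lists R (Suc Q). chain_ok (y * s) (\<lambda>i. X i \<omega>) js}"
      proof (intro card_mono)
        show "finite {js \<in> increasing_lists R (Suc Q). chain_ok (y * s) (\<lambda>i. X i \<omega>) js}"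
          using finite_increasing_lists by simp
        show "{js \<in> increasing_lists R (Suc Q). set js \<subseteq> ?J} \<subseteq> {js \<in> increasing_lists R (Suc Q). chain_ok (y * s) (\<lambda>i. X i \<omega>) js}"
          using chain_ok_near_min unfolding increasing_lists_def by blast
      qed
      finally have "real (N choose Suc Q) \<le> real (card {js\<in>increasing_lists R (Suc Q). chain_ok (y * s) (\<lambda>i. X i \<omega>) js})"
        by simp
      then show ?thesis using True w finite_increasing_lists
        by (simp add: indicator_def sum.If_cases Int_def)
    qed (auto intro!: sum_nonneg)
  qed (use F ok in \<open>auto intro!: integrable_mult_right Bochner_Integration.integrable_sum integrable_real_indicator simp: emeasure_eq_measure\<close>)
  also have "\<dots> = (\<Sum>js\<in>increasing_lists R (Suc Q). prob {\<omega>\<in>space M. chain_ok (y * s) (\<lambda>i. X i \<omega>) js})"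
    using ok by (subst Bochner_Integration.integral_sum) (auto intro!: integrable_real_indicator simp: emeasure_eq_measure)
  also have "\<dots> \<le> (\<Sum>js\<in>increasing_lists R (Suc Q). chain_weight ?c js)"
    using y by (intro sum_mono prob_chain_ok_le) (auto simp: increasing_lists_def)
  also have "\<dots> \<le> real (R + 1) * (?c * harm R) ^ Q"
    by (intro sum_chain_weight_le) simp
  finally show "prob ?F * real (N choose Suc Q) \<le> real (R + 1) * (?c * harm R) ^ Q" .
qed

end

section \<open>Moments of the error for Brownian motion\<close>

lemma points_in_unit:
  assumes "1 \<le> n"
  shows "set (points lam f n) \<subseteq> {0..1}"
proof (cases "n = 1")
  case True
  then show ?thesis unfolding points_def by simp
next
  case False
  then show ?thesis using dyadic_partition_points[of n lam f] assms unfolding dyadic_partition_def by auto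
qed

lemma minimization_error_bounds:
  assumes cont: "continuous_on {0..1} f" and L: "1 \<le> L" and incr: "small_increments f L" and n: "1 \<le> n"
  shows "0 \<le> minimization_error lam n f" "minimization_error lam n f \<le> 60 * sqrt L"
proof -
  have "min_value f (points lam f n) \<in> f ` set (points lam f n)"
    unfolding min_value_def by (intro Min_in) (auto simp: points_def)
  then obtain c where "c \<in> set (points lam f n)" and best: "min_value f (points lam f n) = f c" by auto
  then have c: "c \<in> {0..1}" using points_in_unit[OF n] by blast
  have err: "minimization_error lam n f = f c - (INF t\<in>{0..1}. f t)"
    unfolding minimization_error_def points_def[symmetric] best ..
  have "compact (f ` {0..1})" using cont by (intro compact_continuous_image) auto
  then have "bdd_below (f ` {0..1})" by (simp add: bounded_imp_bdd_below compact_imp_bounded)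
  then have "(INF t\<in>{0..1}. f t) \<le> f c" using c by (intro cINF_lower)
  then show "0 \<le> minimization_error lam n f" unfolding err by simp
  have "dyadic_pair 0 0 1" unfolding dyadic_pair_def by simp
  then have "\<bar>f c - f t\<bar> \<le> 60 * sqrt ((real 0 + L) / 2 ^ 0)" if "t \<in> {0..1}" for t
    using dyadic_modulus_of_small_increments[OF cont L incr] that c unfolding dyadic_modulus_def by blast
  then have osc: "\<bar>f c - f t\<bar> \<le> 60 * sqrt L" if "t \<in> {0..1}" for t using that by simp
  have "f c - 60 * sqrt L \<le> (INF t\<in>{0..1}. f t)"
  proof (rule cINF_greatest)
    fix t :: real assume "t \<in> {0..1}"
    from osc[OF this] show "f c - 60 * sqrt L \<le> f t" by linarith
  qed simp
  then show "minimization_error lam n f \<le> 60 * sqrt L" unfolding err by simp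
qed

context unit_brownian_motion
begin

sublocale continuous_process M W
  by unfold_locales (auto intro: random_variable_W continuous_paths)

definition increment :: "nat \<Rightarrow> nat \<Rightarrow> 'a \<Rightarrow> real" where
  "increment k j \<omega> = W (real (Suc j) / 2 ^ k) \<omega> - W (real j / 2 ^ k) \<omega>"

lemma dyadic_in_unit: "j \<le> 2 ^ k \<Longrightarrow> real j / 2 ^ k \<in> {0..1}"
  by (simp add: divide_le_eq)

lemma increment_normal:
  assumes "j < 2 ^ k"
  shows "distributed M lborel (increment k j) (normal_density 0 (sqrt (1 / 2 ^ k)))"
proof -
  have "real (Suc j) / 2 ^ k \<le> 1" using dyadic_in_unit[of "Suc j" k] assms by simp
  then have "distributed M lborel (increment k j) (normal_density 0 (sqrt (real (Suc j) / 2 ^ k - real j / 2 ^ k)))"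
    unfolding increment_def by (intro normal_increments) (auto simp: divide_strict_right_mono)
  moreover have "real (Suc j) / 2 ^ k - real j / 2 ^ k = 1 / 2 ^ k" by (simp add: diff_divide_distrib[symmetric])
  ultimately show ?thesis by simp
qed

lemma gaussian_walk_increment: "gaussian_walk M (increment k) (2 ^ k) (sqrt (1 / 2 ^ k))"
proof unfold_locales
  let ?t = "\<lambda>i. real i / 2 ^ k"
  have "indep_vars (\<lambda>_. borel) (\<lambda>i \<omega>. W (?t (Suc i)) \<omega> - W (?t i) \<omega>) {..<2 ^ k}"
  proof (rule indep_increments)
    show "?t ` {..2 ^ k} \<subseteq> {0..1}" using dyadic_in_unit by blast
    show "strict_mono_on {..2 ^ k} ?t" by (intro strict_mono_onI) (simp add: divide_strict_right_mono)
  qed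
  then show "indep_vars (\<lambda>_. borel) (increment k) {..<2 ^ k}" unfolding increment_def .
qed (auto intro: increment_normal)

lemma walk_increment:
  assumes "\<omega> \<in> space M"
  shows "gaussian_walk.walk (increment k) j \<omega> = W (real j / 2 ^ k) \<omega>"
proof -
  have "gaussian_walk.walk (increment k) j \<omega> = (\<Sum>l<j. W (real (Suc l) / 2 ^ k) \<omega> - W (real l / 2 ^ k) \<omega>)"
    unfolding gaussian_walk.walk_def[OF gaussian_walk_increment] increment_def ..
  also have "\<dots> = W (real j / 2 ^ k) \<omega> - W (real 0 / 2 ^ k) \<omega>" by (rule sum_lessThan_telescope)
  finally show ?thesis using start_at_0[OF assms] by simp
qed

definition rough :: "real \<Rightarrow> 'a set" where
  "rough L = {\<omega>\<in>space M. \<not> small_increments (path \<omega>) L}"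

text \<open>
  The threshold for an increment of level \<open>k\<close> is \<open>2 sqrt(k + L)\<close> standard deviations, which is
  exceeded with probability at most \<open>2 exp(-2k - 2L)\<close>. The factor \<open>exp(-2k)\<close> outweighs the number
  \<open>2\<^sup>k\<close> of increments of that level.
\<close>

lemma
  assumes "1 \<le> L"
  shows rough_event: "rough L \<in> events"
    and prob_rough_le: "prob (rough L) \<le> 4 * exp (- 2 * L)"
proof -
  define B where "B k j = {\<omega>\<in>space M. 2 * sqrt ((real k + L) / 2 ^ k) < \<bar>increment k j \<omega>\<bar>}" for k j
  define A where "A k = (\<Union>j<2 ^ k. B k j)" for k :: nat
  have B_ev: "B k j \<in> events" if "j < 2 ^ k" for k j
  proof -
    have [measurable]: "increment k j \<in> borel_measurable M"
      using distributed_measurable[OF increment_normal[OF that]] by simp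
    show ?thesis unfolding B_def by measurable
  qed
  have A_ev: "A k \<in> events" for k unfolding A_def using B_ev by auto
  have rough: "rough L = (\<Union>k. A k)"
    unfolding rough_def A_def B_def small_increments_def increment_def by (auto simp: not_le)
  show "rough L \<in> events" unfolding rough using A_ev by auto
  have B_le: "prob (B k j) \<le> 2 * exp (- 2 * L) * (exp (- 2)) ^ k" if "j < 2 ^ k" for k j
  proof -
    have "prob (B k j) \<le> 2 * exp (- (2 * sqrt ((real k + L) / 2 ^ k))\<^sup>2 / (2 * (sqrt (1 / 2 ^ k))\<^sup>2))"
      unfolding B_def using assms by (intro prob_normal_abs_gt_le increment_normal that prob_space_axioms) auto
    also have "- (2 * sqrt ((real k + L) / 2 ^ k))\<^sup>2 / (2 * (sqrt (1 / 2 ^ k))\<^sup>2) = - 2 * L + real k * - 2"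
      using assms by (simp add: power_mult_distrib field_simps)
    also have "exp (- 2 * L + real k * - 2) = exp (- 2 * L) * (exp (- 2)) ^ k"
      unfolding exp_add exp_of_nat_mult ..
    finally show ?thesis by simp
  qed
  have exp_2: "2 * exp (- 2 :: real) \<le> 1 / 2"
  proof -
    have "(2::real) \<le> exp 1" using exp_ge_add_one_self[of 1] by simp
    then have "2 * 2 \<le> exp 1 * exp (1::real)" by (intro mult_mono) auto
    then have "4 \<le> exp (2::real)" by (simp add: exp_add[symmetric])
    then show ?thesis by (simp add: exp_minus field_simps)
  qed
  have A_le: "prob (A k) \<le> 2 * exp (- 2 * L) * (1 / 2) ^ k" for k
  proof -
    have "prob (A k) \<le> (\<Sum>j<2 ^ k. prob (B k j))"
      unfolding A_def using B_ev by (intro measure_UNION_le) auto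
    also have "\<dots> \<le> (\<Sum>j<(2::nat) ^ k. 2 * exp (- 2 * L) * (exp (- 2)) ^ k)"
      using B_le by (intro sum_mono) auto
    also have "\<dots> = 2 * exp (- 2 * L) * (2 * exp (- 2)) ^ k" by (simp add: power_mult_distrib)
    also have "\<dots> \<le> 2 * exp (- 2 * L) * (1 / 2) ^ k"
      using exp_2 by (intro mult_left_mono power_mono) auto
    finally show ?thesis .
  qed
  have geom: "(\<lambda>k. 2 * exp (- 2 * L) * (1 / 2) ^ k) sums (2 * exp (- 2 * L) * 2)"
    using geometric_sums[of "1 / 2 :: real"] by (intro sums_mult) simp
  then have summ: "summable (\<lambda>k. prob (A k))"
    by (intro summable_comparison_test[OF _ sums_summable[OF geom]] exI[of _ 0]) (use A_le in auto)
  have "prob (rough L) \<le> (\<Sum>k. prob (A k))"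
    unfolding rough using A_ev summ by (intro finite_measure_subadditive_countably) auto
  also have "\<dots> \<le> 2 * exp (- 2 * L) * 2"
    unfolding sums_unique[OF geom] by (intro suminf_le A_le summ sums_summable[OF geom])
  finally show "prob (rough L) \<le> 4 * exp (- 2 * L)" by simp
qed

lemma error_bounds:
  assumes "\<omega> \<in> space M" "\<omega> \<notin> rough L" "1 \<le> L" "1 \<le> n"
  shows "\<bar>minimization_error lam n (path \<omega>)\<bar> \<le> 60 * sqrt L"
  using minimization_error_bounds[OF W_continuous[OF assms(1)] assms(3) _ assms(4), of lam] assms
  unfolding rough_def by auto

text \<open>
  The error is at most the oscillation of the path, which is at most \<open>60 sqrt L\<close> outside
  \<open>rough L\<close>. Slicing by the first integer \<open>L\<close> for which the path is not rough, the exponential decay of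
  the probability of \<open>rough L\<close> beats every power of \<open>L\<close>.
\<close>

lemma nn_integral_error_moment_le:
  assumes q: "0 \<le> q"
  shows "\<exists>C\<ge>0. \<forall>n\<ge>1. \<forall>lam.
    (\<integral>\<^sup>+\<omega>. ennreal (\<bar>minimization_error lam n (path \<omega>)\<bar> powr q) \<partial>M) \<le> ennreal C"
proof -
  define c where "c i = (60 * sqrt (real i + 1)) powr q" for i :: nat
  define T where "T i = c (Suc i) * (4 * exp (- 2 * (real i + 1)))" for i
  have c1: "1 \<le> c i" for i
  proof -
    have "1 \<le> sqrt (real i + 1)" by simp
    then have "1 \<le> 60 * sqrt (real i + 1)" by linarith
    then show ?thesis unfolding c_def using q by (rule ge_one_powr_ge_zero)
  qed
  have "T \<in> O(\<lambda>i. exp (- real i))" unfolding T_def c_def by real_asymp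
  moreover have "summable (\<lambda>i. norm (exp (- real i)))"
  proof -
    have "norm (exp (- real i)) = exp (- 1) ^ i" for i by (simp add: exp_of_nat_mult[symmetric])
    then show ?thesis by (simp add: summable_geometric)
  qed
  ultimately have T: "summable T" by (rule summable_comparison_test_bigo[rotated])
  have T0: "0 \<le> T i" for i unfolding T_def using c1[of "Suc i"] by simp
  have "(\<integral>\<^sup>+\<omega>. ennreal (\<bar>minimization_error lam n (path \<omega>)\<bar> powr q) \<partial>M) \<le> ennreal (c 0 + (\<Sum>i. T i))"
    if n: "1 \<le> n" for n lam
  proof -
    let ?e = "\<lambda>\<omega>. \<bar>minimization_error lam n (path \<omega>)\<bar>"
    let ?S = "\<lambda>\<omega>. \<Sum>i. ennreal (c (Suc i)) * indicator (rough (real i + 1)) \<omega>"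
    have bound: "?e \<omega> powr q \<le> c i" if "\<omega> \<in> space M" "\<omega> \<notin> rough (real i + 1)" for \<omega> i
      unfolding c_def using error_bounds[OF that _ n] q by (intro powr_mono2) auto
    have "ennreal (?e \<omega> powr q) \<le> ennreal (c 0) + ?S \<omega>" if w: "\<omega> \<in> space M" for \<omega>
    proof (cases "\<exists>i. \<omega> \<notin> rough (real i + 1)")
      case True
      define i where "i = (LEAST i. \<omega> \<notin> rough (real i + 1))"
      have i: "\<omega> \<notin> rough (real i + 1)" unfolding i_def using LeastI_ex[OF True] .
      show ?thesis
      proof (cases i)
        case 0
        then have "ennreal (?e \<omega> powr q) \<le> ennreal (c 0)" using bound[OF w i] by (intro ennreal_leI) simp
        then show ?thesis by (meson add_increasing2 order_trans zero_le)
      next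
        case (Suc j)
        then have "\<omega> \<in> rough (real j + 1)" using not_less_Least[of j "\<lambda>i. \<omega> \<notin> rough (real i + 1)"]
          unfolding i_def[symmetric] by auto
        then have "ennreal (?e \<omega> powr q) \<le> ennreal (c (Suc j)) * indicator (rough (real j + 1)) \<omega>"
          using bound[OF w i] Suc by (simp add: ennreal_leI)
        also have "\<dots> \<le> ?S \<omega>"
        proof -
          have "t j \<le> suminf t" for t :: "nat \<Rightarrow> ennreal" using sum_le_suminf[of t "{j}"] by simp
          then show ?thesis .
        qed
        finally show ?thesis by (meson add_increasing order_trans zero_le)
      qed
    next
      case False
      \<comment> \<open>If the path is rough for every L, the right-hand side is infinite.\<close>
      obtain N :: nat where N: "?e \<omega> powr q \<le> real N" using real_arch_simple by blast
      have "ennreal (?e \<omega> powr q) \<le> ennreal (real N)" using N by (rule ennreal_leI)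
      also have "\<dots> = (\<Sum>i<N. 1)" by (simp add: ennreal_of_nat_eq_real_of_nat)
      also have "\<dots> \<le> (\<Sum>i<N. ennreal (c (Suc i)) * indicator (rough (real i + 1)) \<omega>)"
        using False c1 by (intro sum_mono) (simp add: ennreal_ge_1)
      also have "\<dots> \<le> ?S \<omega>" by (intro sum_le_suminf) auto
      finally show ?thesis by (meson add_increasing order_trans zero_le)
    qed
    then have "(\<integral>\<^sup>+\<omega>. ennreal (?e \<omega> powr q) \<partial>M) \<le> (\<integral>\<^sup>+\<omega>. ennreal (c 0) + ?S \<omega> \<partial>M)"
      by (intro nn_integral_mono)
    also have "\<dots> = ennreal (c 0) + (\<Sum>i. \<integral>\<^sup>+\<omega>. ennreal (c (Suc i)) * indicator (rough (real i + 1)) \<omega> \<partial>M)"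
      using rough_event by (subst nn_integral_add) (auto simp: nn_integral_suminf emeasure_space_1)
    also have "\<dots> \<le> ennreal (c 0) + (\<Sum>i. ennreal (T i))"
    proof (intro add_left_mono suminf_le)
      fix i
      have "(\<integral>\<^sup>+\<omega>. ennreal (c (Suc i)) * indicator (rough (real i + 1)) \<omega> \<partial>M) = ennreal (c (Suc i) * prob (rough (real i + 1)))"
        using rough_event[of "real i + 1"] c1[of "Suc i"]
        by (subst nn_integral_cmult_indicator) (auto simp: emeasure_eq_measure ennreal_mult')
      also have "\<dots> \<le> ennreal (T i)"
        unfolding T_def using prob_rough_le[of "real i + 1"] c1[of "Suc i"] by (intro ennreal_leI mult_left_mono) auto
      finally show "(\<integral>\<^sup>+\<omega>. ennreal (c (Suc i)) * indicator (rough (real i + 1)) \<omega> \<partial>M) \<le> ennreal (T i)" .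
    qed auto
    also have "\<dots> = ennreal (c 0 + (\<Sum>i. T i))"
      using T T0 c1[of 0] by (simp add: suminf_ennreal2 suminf_nonneg)
    finally show ?thesis .
  qed
  moreover have "0 \<le> c 0 + (\<Sum>i. T i)" using c1[of 0] suminf_nonneg[OF T T0] by linarith
  ultimately show ?thesis by blast
qed

end

section \<open>The event on which the error is large\<close>

lemma harm_le_one_plus_ln: "harm (Suc n) \<le> 1 + ln (real (Suc n))"
  using decseqD[OF decseq_harm_diff_ln, of 0 n] by (simp add: harm_expand)

lemma harm_power_2_le: "harm (2 ^ k) \<le> 1 + real k"
proof -
  obtain n where n: "2 ^ k = Suc n" by (metis not0_implies_Suc power_not_zero zero_neq_numeral)
  have "harm (2 ^ k) \<le> 1 + ln (real (2 ^ k))" unfolding n by (rule harm_le_one_plus_ln)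
  also have "ln (real (2 ^ k)) = real k * ln 2" by (simp add: ln_realpow)
  also have "1 + real k * ln 2 \<le> 1 + real k * 1" using ln_2_less_1 by (intro add_left_mono mult_left_mono) auto
  finally show ?thesis by simp
qed

lemma power_2_log_le:
  assumes "real m \<le> a * log 2 (real n) + 1" "1 \<le> n"
  shows "2 ^ m \<le> 2 * real n powr a"
proof -
  have "(2::real) ^ m = 2 powr real m" by (simp add: powr_realpow)
  also have "\<dots> \<le> 2 powr (a * log 2 (real n) + 1)" using assms by (intro powr_mono) auto
  also have "\<dots> = 2 * (2 powr log 2 (real n)) powr a" by (simp add: powr_add powr_powr mult.commute)
  also have "2 powr log 2 (real n) = real n" using assms by simp
  finally show ?thesis .
qed

context unit_brownian_motion
begin

definition crowded :: "nat \<Rightarrow> real \<Rightarrow> nat \<Rightarrow> 'a set" where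
  "crowded k y N = {\<omega>\<in>space M. Suc N \<le> card (gaussian_walk.near_walk_min (increment k) (2 ^ k) (sqrt (1 / 2 ^ k)) y \<omega>)}"

lemma
  assumes "0 \<le> y" "k < m"
  shows crowded_event: "crowded k y N \<in> events"
    and prob_crowded_le: "prob (crowded k y N) * real (Suc N choose Suc Q) \<le>
      2 ^ m * (3 * (y + 2 * sqrt (real m) + 4)\<^sup>2 * (real m + 1)) ^ Q"
proof -
  interpret G: gaussian_walk M "increment k" "2 ^ k" "sqrt (1 / 2 ^ k)" by (rule gaussian_walk_increment)
  show "crowded k y N \<in> events" unfolding crowded_def by (rule G.prob_many_near_min_le(1)[OF assms(1)])
  have barrier: "0 \<le> G.barrier y" using G.barrier_ge_1[OF assms(1)] by simp
  have "real (2 ^ k + 1) * (3 * (G.barrier y)\<^sup>2 * harm (2 ^ k)) ^ Q \<le> 2 ^ m * (3 * (y + 2 * sqrt (real m) + 4)\<^sup>2 * (real m + 1)) ^ Q"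
  proof (intro mult_mono power_mono)
    have "(2::nat) ^ k + 1 \<le> 2 ^ Suc k" by simp
    also have "\<dots> \<le> 2 ^ m" using assms by (intro power_increasing) auto
    finally show "real (2 ^ k + 1) \<le> 2 ^ m" by (metis of_nat_le_iff of_nat_numeral of_nat_power)
    have "ln (real (2 ^ k)) = real k * ln 2" by (simp add: ln_realpow)
    also have "\<dots> \<le> real m * 1" using ln_2_less_1 assms by (intro mult_mono) auto
    finally show "G.barrier y \<le> y + 2 * sqrt (real m) + 4" unfolding G.barrier_def by simp
    show "harm (2 ^ k) \<le> real m + 1" using harm_power_2_le[of k] assms by simp
  qed (use barrier in \<open>auto intro!: harm_nonneg zero_le_power mult_nonneg_nonneg\<close>)
  moreover have "prob (crowded k y N) * real (Suc N choose Suc Q) \<le> real (2 ^ k + 1) * (3 * (G.barrier y)\<^sup>2 * harm (2 ^ k)) ^ Q"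
    unfolding crowded_def by (rule G.prob_many_near_min_le(2)[OF assms(1)])
  ultimately show "prob (crowded k y N) * real (Suc N choose Suc Q) \<le>
      2 ^ m * (3 * (y + 2 * sqrt (real m) + 4)\<^sup>2 * (real m + 1)) ^ Q"
    by (rule order_trans[rotated])
qed

text \<open>
  The minimum over the dyadic grid is at least the infimum of the path, so points near the latter are
  near the former. The two thresholds agree because \<open>sqrt(H / 2\<^sup>k) = sqrt H * sqrt(1 / 2\<^sup>k)\<close>.
\<close>

lemma card_near_min_le:
  assumes w: "\<omega> \<in> space M" "\<omega> \<notin> crowded k (3 * sqrt (tame_path.near_min_bound lam K L m)) N"
    and tame: "tame_path (path \<omega>) lam K L"
  shows "card (tame_path.near_min (path \<omega>) lam K L m k) \<le> N"
proof -
  interpret T: tame_path "path \<omega>" lam K L by fact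
  interpret G: gaussian_walk M "increment k" "2 ^ k" "sqrt (1 / 2 ^ k)" by (rule gaussian_walk_increment)
  let ?y = "3 * sqrt (T.near_min_bound m)"
  have "T.near_min m k \<subseteq> G.near_walk_min ?y \<omega>"
  proof
    fix j assume j: "j \<in> T.near_min m k"
    have "W (real j / 2 ^ k) \<omega> \<le> W (real i / 2 ^ k) \<omega> + ?y * sqrt (1 / 2 ^ k)" if "i \<le> 2 ^ k" for i
    proof -
      have "W (real j / 2 ^ k) \<omega> \<le> T.infimum + 3 * sqrt (T.near_min_bound m / 2 ^ k)"
        using j unfolding T.near_min_def by simp
      moreover have "T.infimum \<le> W (real i / 2 ^ k) \<omega>"
        using dyadic_in_unit[OF that] by (rule T.infimum_le)
      ultimately show ?thesis by (simp add: real_sqrt_divide)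
    qed
    then show "j \<in> G.near_walk_min ?y \<omega>"
      using j unfolding G.near_walk_min_def T.near_min_def walk_increment[OF w(1)] by simp
  qed
  moreover have "finite (G.near_walk_min ?y \<omega>)" unfolding G.near_walk_min_def by simp
  ultimately have "card (T.near_min m k) \<le> card (G.near_walk_min ?y \<omega>)" by (intro card_mono)
  then show ?thesis using w unfolding crowded_def by simp
qed

text \<open>
  Here the parameters are matched. The probability of rough paths is fixed by \<open>L = q log n\<close>, which
  determines \<open>\<lambda>\<close>; the order of the error is fixed by the level \<open>m\<close>, about \<open>4 r log\<^sub>2 n\<close>. Measured
  in standard deviations of one increment, the threshold for being near the minimum is then of
  order \<open>sqrt(log n)\<close>, so that the bound on the expected number of \<open>Q\<close>-tuples, divided by \<open>n\<close> to
  the power \<open>Q/2\<close>, is as small as required once \<open>Q\<close> is large.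
\<close>

lemma error_le_outside_rare_event:
  assumes r: "1 \<le> r" and q: "1 \<le> q"
  shows "\<exists>lam\<ge>1. \<exists>C\<ge>0. \<exists>C'\<ge>0. \<exists>n0. \<forall>n\<ge>n0. \<exists>B\<in>events. prob B \<le> C' * real n powr (- 2 * q) \<and>
    (\<forall>\<omega>\<in>space M - B. \<bar>minimization_error lam n (path \<omega>)\<bar> \<le> C * real n powr (- r))"
proof -
  \<comment> \<open>7200 is twice the square of the constant 60 in the modulus of continuity.\<close>
  define lam where "lam = 7200 * (1 + 3 * q)"
  \<comment> \<open>The moment bound below carries the exponent 4r + Q/4 - (Q+1)/2, which must not exceed -2q - 1.\<close>
  define Q where "Q = nat \<lceil>4 * (1 + 4 * r + 2 * q)\<rceil>"
  define L where "L n = q * ln (real n)" for n :: nat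
  define m where "m n = nat \<lceil>4 * r * log 2 (real n)\<rceil>" for n :: nat
  define N where "N n = nat \<lceil>sqrt (real n)\<rceil>" for n :: nat
  define y where "y n = 3 * sqrt (tame_path.near_min_bound lam 60 (L n) (m n))" for n :: nat
  define B where "B n = rough (L n) \<union> (\<Union>k<m n. crowded k (y n) (N n))" for n
  define u where "u x = 4 * r * log 2 x + 1" for x :: real
  \<comment> \<open>With t = log n, the level m is at most c t, and the barrier height is at most E sqrt t.\<close>
  define c where "c = 8 * r + 1"
  define E where "E = 3 * (sqrt (lam * c) + 60 * sqrt (c + q)) + 2 * sqrt c + 4"
  define v where "v x = 3 * E\<^sup>2 * (c + 1) * (ln x)\<^sup>2" for x :: real
  define D where "D = 2 * real (Suc Q) ^ Suc Q"
  have lam: "1 \<le> lam" "0 < lam" unfolding lam_def using q by auto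
  have "\<forall>\<^sub>F n in sequentially. v (real n) \<le> real n powr (1 / 4)"
    unfolding v_def by real_asymp
  moreover have "\<forall>\<^sub>F n in sequentially. u (real n) \<le> real n"
    unfolding u_def using r by real_asymp
  moreover have "\<forall>\<^sub>F n in sequentially. 4 * u (real n) * (sqrt (real n) + 1) + 2 < real n"
    unfolding u_def using r by real_asymp
  moreover have "\<forall>\<^sub>F n in sequentially. real Q \<le> sqrt (real n)" by real_asymp
  moreover have "\<forall>\<^sub>F n in sequentially. 1 \<le> L n"
    unfolding L_def using q by real_asymp
  moreover have "\<forall>\<^sub>F n in sequentially. 1 \<le> ln (real n)" by real_asymp
  moreover have "\<forall>\<^sub>F n in sequentially. 4 \<le> n" by (rule eventually_ge_at_top)
  ultimately have "\<forall>\<^sub>F n in sequentially. B n \<in> events \<and> prob (B n) \<le> (4 + D) * real n powr (- 2 * q) \<and>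
    (\<forall>\<omega>\<in>space M - B n. \<bar>minimization_error lam n (path \<omega>)\<bar> \<le> 4 * sqrt lam * real n powr (- r))"
  proof eventually_elim
    case (elim n)
    have n: "1 \<le> n" using elim by simp
    have m_real: "4 * r * log 2 (real n) \<le> real (m n)" "real (m n) \<le> u (real n)"
    proof -
      have "0 \<le> 4 * r * log 2 (real n)" using r n by simp
      then have "real (m n) = of_int \<lceil>4 * r * log 2 (real n)\<rceil>" unfolding m_def by simp
      then show "4 * r * log 2 (real n) \<le> real (m n)" "real (m n) \<le> u (real n)" unfolding u_def by linarith+
    qed
    have N_real: "sqrt (real n) \<le> real (N n)" "real (N n) \<le> sqrt (real n) + 1"
    proof -
      have "0 \<le> sqrt (real n)" by simp
      then have "0 \<le> \<lceil>sqrt (real n)\<rceil>" by linarith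
      then have "real (N n) = of_int \<lceil>sqrt (real n)\<rceil>" unfolding N_def by simp
      then show "sqrt (real n) \<le> real (N n)" "real (N n) \<le> sqrt (real n) + 1" by linarith+
    qed
    have y: "y n = 3 * (sqrt (lam * real (m n)) + 60 * sqrt (real (m n) + L n))" "0 \<le> y n"
    proof -
      have "tame_path.near_min_bound lam 60 (L n) (m n) = (sqrt (lam * real (m n)) + 60 * sqrt (real (m n) + L n))\<^sup>2"
      proof -
        have "small_increments (\<lambda>_. 0) (L n)" using elim by (simp add: small_increments_def)
        then have "tame_path (\<lambda>_. 0) lam 60 (L n)"
          using elim lam by unfold_locales (auto intro: dyadic_modulus_of_small_increments)
        then show ?thesis by (rule tame_path.near_min_bound_def)
      qed
      then show "y n = 3 * (sqrt (lam * real (m n)) + 60 * sqrt (real (m n) + L n))" unfolding y_def using lam elim by simp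
      then show "0 \<le> y n" using lam elim by simp
    qed
    have crowded_ev: "crowded k (y n) (N n) \<in> events" for k
      using crowded_event[OF y(2), of k "Suc k"] by simp
    have B_ev: "B n \<in> events" unfolding B_def using crowded_ev rough_event elim by auto
    have rough_le: "prob (rough (L n)) \<le> 4 * real n powr (- 2 * q)"
    proof -
      have "exp (- 2 * L n) = real n powr (- 2 * q)" unfolding L_def powr_def using n by simp
      then show ?thesis using prob_rough_le[of "L n"] elim by simp
    qed
    have crowded_le: "prob (crowded k (y n) (N n)) \<le> D * real n powr (- 2 * q - 1)" if k: "k < m n" for k
    proof -
      define t where "t = ln (real n)"
      have t: "1 \<le> t" "1 \<le> sqrt t" unfolding t_def using elim by auto
      have c: "1 \<le> c" unfolding c_def using r by simp
      have mt: "real (m n) \<le> c * t"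
      proof -
        have "ln (real n) * 1 \<le> ln (real n) * (2 * ln 2)"
          using t ln2_ge_two_thirds unfolding t_def by (intro mult_left_mono) auto
        then have "log 2 (real n) \<le> 2 * t" unfolding t_def log_def by (simp add: divide_le_eq)
        then have "4 * r * log 2 (real n) \<le> 4 * r * (2 * t)" using r by (intro mult_left_mono) auto
        then show ?thesis using m_real(2) t unfolding u_def c_def by (simp add: algebra_simps)
      qed
      have sqrts: "sqrt (lam * real (m n)) \<le> sqrt (lam * c) * sqrt t"
        "sqrt (real (m n) + L n) \<le> sqrt (c + q) * sqrt t" "sqrt (real (m n)) \<le> sqrt c * sqrt t"
        unfolding real_sqrt_mult[symmetric] L_def t_def[symmetric]
        using mt mult_left_mono[OF mt, of lam] lam by (simp_all add: algebra_simps)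
      have sum_le: "3 * (a1 + 60 * a2) + 2 * a3 + 4 \<le> 3 * (b1 + 60 * b2) + 2 * b3 + 4 * s"
        if "a1 \<le> b1" "a2 \<le> b2" "a3 \<le> b3" "1 \<le> s" for a1 a2 a3 b1 b2 b3 s :: real
        using that by (intro add_mono mult_left_mono) auto
      have "E * sqrt t = 3 * (sqrt (lam * c) * sqrt t + 60 * (sqrt (c + q) * sqrt t)) + 2 * (sqrt c * sqrt t) + 4 * sqrt t"
        unfolding E_def by (simp add: algebra_simps)
      then have "y n + 2 * sqrt (real (m n)) + 4 \<le> E * sqrt t"
        unfolding y(1) using sum_le[OF sqrts t(2)] by simp
      then have "(y n + 2 * sqrt (real (m n)) + 4)\<^sup>2 \<le> (E * sqrt t)\<^sup>2"
        using y(2) by (intro power_mono) auto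
      also have "\<dots> = E\<^sup>2 * t" using t by (simp add: power_mult_distrib)
      finally have "3 * (y n + 2 * sqrt (real (m n)) + 4)\<^sup>2 * (real (m n) + 1) \<le> 3 * (E\<^sup>2 * t) * ((c + 1) * t)"
        using mt t by (intro mult_mono) (auto simp: algebra_simps)
      also have "\<dots> = v (real n)" unfolding v_def t_def by (simp add: power2_eq_square)
      also have "\<dots> \<le> real n powr (1 / 4)" using elim by simp
      finally have v: "3 * (y n + 2 * sqrt (real (m n)) + 4)\<^sup>2 * (real (m n) + 1) \<le> real n powr (1 / 4)" .
      have "prob (crowded k (y n) (N n)) * real (Suc (N n) choose Suc Q) \<le>
          2 ^ m n * (3 * (y n + 2 * sqrt (real (m n)) + 4)\<^sup>2 * (real (m n) + 1)) ^ Q"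
        by (rule prob_crowded_le[OF y(2) k])
      also have "\<dots> \<le> (2 * real n powr (4 * r)) * (real n powr (1 / 4)) ^ Q"
        using v m_real n unfolding u_def by (intro mult_mono power_mono power_2_log_le) auto
      also have "\<dots> = 2 * real n powr (4 * r + real Q / 4)"
        using n by (simp add: powr_power powr_add)
      finally have upper: "prob (crowded k (y n) (N n)) * real (Suc (N n) choose Suc Q) \<le> 2 * real n powr (4 * r + real Q / 4)" .
      have "(real n powr (1 / 2) / real (Suc Q)) ^ Suc Q \<le> (real (Suc (N n)) / real (Suc Q)) ^ Suc Q"
        using N_real n by (intro power_mono divide_right_mono) (auto simp: powr_half_sqrt)
      also have "\<dots> \<le> real (Suc (N n) choose Suc Q)"
      proof -
        have "real Q \<le> real (N n)" using elim N_real by linarith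
        then have "Suc Q \<le> Suc (N n)" by simp
        from binomial_ge_n_over_k_pow_k[OF this, where ?'a=real] show ?thesis by simp
      qed
      finally have "prob (crowded k (y n) (N n)) * (real n powr (1 / 2) / real (Suc Q)) ^ Suc Q \<le> 2 * real n powr (4 * r + real Q / 4)"
        using upper mult_left_mono[of _ _ "prob (crowded k (y n) (N n))"] by (meson measure_nonneg order_trans)
      moreover have "(real n powr (1 / 2) / real (Suc Q)) ^ Suc Q = real n powr (real (Suc Q) / 2) / real (Suc Q) ^ Suc Q"
        using n by (simp add: power_divide powr_power del: power_Suc of_nat_Suc)
      ultimately have "prob (crowded k (y n) (N n)) * real n powr (real (Suc Q) / 2) \<le> D * real n powr (4 * r + real Q / 4)"
        unfolding D_def by (simp add: field_simps del: power_Suc of_nat_Suc)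
      then have "prob (crowded k (y n) (N n)) \<le> D * real n powr (4 * r + real Q / 4) / real n powr (real (Suc Q) / 2)"
        using n by (simp add: pos_le_divide_eq)
      also have "\<dots> = D * real n powr (4 * r + real Q / 4 - real (Suc Q) / 2)"
        by (simp add: powr_diff)
      also have "\<dots> \<le> D * real n powr (- 2 * q - 1)"
      proof (intro mult_left_mono powr_mono)
        have "4 * (1 + 4 * r + 2 * q) \<le> real Q" unfolding Q_def by linarith
        then show "4 * r + real Q / 4 - real (Suc Q) / 2 \<le> - 2 * q - 1" by (simp add: field_simps)
      qed (use n D_def in auto)
      finally show ?thesis .
    qed
    have "prob (B n) \<le> prob (rough (L n)) + prob (\<Union>k<m n. crowded k (y n) (N n))"
      unfolding B_def using crowded_ev rough_event elim by (intro measure_Un_le) auto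
    also have "prob (\<Union>k<m n. crowded k (y n) (N n)) \<le> (\<Sum>k<m n. prob (crowded k (y n) (N n)))"
      using crowded_ev by (intro measure_UNION_le) auto
    also have "\<dots> \<le> (\<Sum>k<m n. D * real n powr (- 2 * q - 1))"
      using crowded_le by (intro sum_mono) auto
    also have "\<dots> = real (m n) * (D * real n powr (- 2 * q - 1))" by simp
    also have "\<dots> \<le> real n * (D * real n powr (- 2 * q - 1))"
      using m_real elim unfolding D_def by (intro mult_right_mono) auto
    also have "\<dots> = D * real n powr (- 2 * q)"
    proof -
      have "real n powr (- 2 * q) = real n powr (1 + (- 2 * q - 1))" by simp
      also have "\<dots> = real n powr 1 * real n powr (- 2 * q - 1)" by (rule powr_add)
      finally show ?thesis using n by simp
    qed
    finally have prob_B: "prob (B n) \<le> (4 + D) * real n powr (- 2 * q)"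
      using rough_le by (simp add: algebra_simps)
    have good: "\<bar>minimization_error lam n (path \<omega>)\<bar> \<le> 4 * sqrt lam * real n powr (- r)" if w: "\<omega> \<in> space M - B n" for \<omega>
    proof -
      have incr: "small_increments (path \<omega>) (L n)" using w unfolding B_def rough_def by auto
      have cont: "continuous_on {0..1} (path \<omega>)" using w W_continuous by blast
      have L1: "1 \<le> L n" using elim by simp
      have tame: "tame_path (path \<omega>) lam 60 (L n)"
        using cont dyadic_modulus_of_small_increments[OF cont L1 incr] L1 lam by unfold_locales auto
      have large: "4 * m n * N n + 2 < n"
      proof -
        have "4 * real (m n) * real (N n) \<le> 4 * u (real n) * (sqrt (real n) + 1)"
          using m_real N_real by (intro mult_mono) auto
        then have "real (4 * m n * N n + 2) < real n" using elim by simp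
        then show ?thesis by linarith
      qed
      have N: "card (tame_path.near_min (path \<omega>) lam 60 (L n) (m n) k) \<le> N n" if "k < m n" for k
        using w that unfolding B_def y_def by (intro card_near_min_le tame) auto
      have "minimization_error lam n (path \<omega>) \<le> 4 * sqrt lam * real n powr (- r)"
        by (rule tame_path.error_le[OF tame, where q=q and m="m n" and N="N n"])
          (use elim q N m_real large in \<open>auto simp: L_def lam_def\<close>)
      moreover have "0 \<le> minimization_error lam n (path \<omega>)"
        using minimization_error_bounds[OF cont L1 incr n] by simp
      ultimately show ?thesis by simp
    qed
    show ?case using B_ev prob_B good by blast
  qed
  then obtain n0 where "\<forall>n\<ge>n0. B n \<in> events \<and> prob (B n) \<le> (4 + D) * real n powr (- 2 * q) \<and>
    (\<forall>\<omega>\<in>space M - B n. \<bar>minimization_error lam n (path \<omega>)\<bar> \<le> 4 * sqrt lam * real n powr (- r))"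
    unfolding eventually_sequentially by blast
  moreover have "0 \<le> 4 * sqrt lam" "0 \<le> 4 + D" using lam unfolding D_def by auto
  ultimately show ?thesis using lam by blast
qed

text \<open>
  On the rare event \<open>B\<close> the error is not small, but \<open>x \<le> x\<^sup>2 / a + a\<close> with \<open>a\<close> a power of \<open>n\<close> trades
  it against a bounded higher moment and the probability of \<open>B\<close>, each gaining the factor
  \<open>1/a\<close>. The finitely many small \<open>n\<close> are absorbed by the constant.
\<close>

lemma moment_le:
  assumes r: "1 \<le> r" and p: "1 \<le> p"
  shows "\<exists>lam\<ge>1. \<exists>D>0. \<forall>n\<ge>1.
    (\<integral>\<^sup>+\<omega>. ennreal (\<bar>minimization_error lam n (path \<omega>)\<bar> powr p) \<partial>M) \<le> ennreal (D * real n powr (- (r * p)))"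
proof -
  define q where "q = r * p"
  have q: "1 \<le> q" unfolding q_def using r p mult_mono[of 1 r 1 p] by simp
  obtain lam C C' n0 where lam: "1 \<le> lam" and C: "0 \<le> C" "0 \<le> C'"
    and rare: "\<And>n. n \<ge> n0 \<Longrightarrow> \<exists>B\<in>events. prob B \<le> C' * real n powr (- 2 * q) \<and>
      (\<forall>\<omega>\<in>space M - B. \<bar>minimization_error lam n (path \<omega>)\<bar> \<le> C * real n powr (- r))"
    using error_le_outside_rare_event[OF r q] by metis
  obtain C1 where C1: "0 \<le> C1" "\<And>n lam. 1 \<le> n \<Longrightarrow>
      (\<integral>\<^sup>+\<omega>. ennreal (\<bar>minimization_error lam n (path \<omega>)\<bar> powr p) \<partial>M) \<le> ennreal C1"
    using nn_integral_error_moment_le[of p] p by auto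
  obtain C2 where C2: "0 \<le> C2" "\<And>n lam. 1 \<le> n \<Longrightarrow>
      (\<integral>\<^sup>+\<omega>. ennreal (\<bar>minimization_error lam n (path \<omega>)\<bar> powr (2 * p)) \<partial>M) \<le> ennreal C2"
    using nn_integral_error_moment_le[of "2 * p"] p by auto
  define D where "D = 1 + C powr p + C2 + C' + C1 * real (Suc n0) powr q"
  have "(\<integral>\<^sup>+\<omega>. ennreal (\<bar>minimization_error lam n (path \<omega>)\<bar> powr p) \<partial>M) \<le> ennreal (D * real n powr (- q))"
    if n: "1 \<le> n" for n
  proof (cases "n0 \<le> n")
    case False
    have "1 \<le> real (Suc n0) powr q * real n powr (- q)"
    proof -
      have "1 \<le> (real (Suc n0) / real n) powr q" using n False q by (intro ge_one_powr_ge_zero) auto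
      then show ?thesis using n by (simp add: powr_divide powr_minus_divide)
    qed
    then have "C1 * 1 \<le> C1 * (real (Suc n0) powr q * real n powr (- q))" using C1 by (intro mult_left_mono)
    also have "\<dots> \<le> D * real n powr (- q)"
      unfolding D_def mult.assoc[symmetric] using C C2 by (intro mult_right_mono) auto
    finally have "C1 \<le> D * real n powr (- q)" by simp
    then show ?thesis using C1(2)[OF n, of lam] ennreal_leI order_trans by blast
  next
    case True
    let ?e = "\<lambda>\<omega>. \<bar>minimization_error lam n (path \<omega>)\<bar>" and ?a = "real n powr q"
    obtain B where B: "B \<in> events" "prob B \<le> C' * real n powr (- 2 * q)"
      "\<And>\<omega>. \<omega> \<in> space M - B \<Longrightarrow> ?e \<omega> \<le> C * real n powr (- r)"
      using rare[OF True] by blast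
    have a: "0 < ?a" "real n powr (- q) = 1 / ?a" "real n powr (- 2 * q) = 1 / (?a * ?a)"
      using n by (simp_all add: powr_minus_divide powr_add[symmetric])
    have [measurable]: "(\<lambda>\<omega>. minimization_error lam n (path \<omega>)) \<in> borel_measurable M"
      by (rule minimization_error_measurable[OF n])
    have pointwise: "?e \<omega> powr p \<le> C powr p / ?a + 1 / ?a * ?e \<omega> powr (2 * p) + ?a * indicator B \<omega>"
      if w: "\<omega> \<in> space M" for \<omega>
    proof (cases "\<omega> \<in> B")
      case True
      let ?x = "?e \<omega> powr p"
      have x2: "?e \<omega> powr (2 * p) = ?x * ?x" by (simp add: powr_add[symmetric])
      have "?x \<le> 1 / ?a * (?x * ?x) + ?a"
      proof (cases "?x \<le> ?a")
        case False
        then have "?a * ?x \<le> ?x * ?x" by (intro mult_right_mono) auto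
        then have "?x \<le> 1 / ?a * (?x * ?x)" using a(1) by (simp add: field_simps)
        then show ?thesis using a(1) by linarith
      qed (use a(1) in \<open>auto intro: add_increasing\<close>)
      then have "?x \<le> C powr p / ?a + (1 / ?a * (?x * ?x) + ?a)" by (rule add_increasing[rotated]) simp
      then show ?thesis using True unfolding x2 by (simp add: add.assoc)
    next
      case False
      have "?e \<omega> powr p \<le> (C * real n powr (- r)) powr p" using B(3)[of \<omega>] w False p by (intro powr_mono2) auto
      also have "\<dots> = C powr p / ?a"
        using C by (simp add: powr_minus_divide powr_divide powr_powr q_def)
      finally show ?thesis using False a(1) by (simp add: add_increasing2)
    qed
    have "(\<integral>\<^sup>+\<omega>. ennreal (?e \<omega> powr p) \<partial>M) \<le>
      (\<integral>\<^sup>+\<omega>. ennreal (C powr p / ?a) + ennreal (1 / ?a) * ennreal (?e \<omega> powr (2 * p)) + ennreal ?a * indicator B \<omega> \<partial>M)"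
    proof (rule nn_integral_mono)
      fix \<omega> assume "\<omega> \<in> space M"
      from ennreal_leI[OF pointwise[OF this]]
      show "ennreal (?e \<omega> powr p) \<le> ennreal (C powr p / ?a) + ennreal (1 / ?a) * ennreal (?e \<omega> powr (2 * p)) + ennreal ?a * indicator B \<omega>"
        using a(1) by (simp add: ennreal_mult'[symmetric] ennreal_indicator[symmetric] ennreal_plus[symmetric] del: ennreal_plus)
    qed
    also have "\<dots> = ennreal (C powr p / ?a) + ennreal (1 / ?a) * (\<integral>\<^sup>+\<omega>. ennreal (?e \<omega> powr (2 * p)) \<partial>M) + ennreal ?a * emeasure M B"
      using B(1) by (simp add: nn_integral_add nn_integral_cmult nn_integral_cmult_indicator emeasure_space_1)
    also have "\<dots> \<le> ennreal (C powr p / ?a) + ennreal (1 / ?a) * ennreal C2 + ennreal ?a * ennreal (C' / (?a * ?a))"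
      using C2(2)[OF n, of lam] B(2) a by (intro add_mono mult_left_mono) (auto simp: emeasure_eq_measure intro: ennreal_leI)
    also have "\<dots> = ennreal (C powr p / ?a + 1 / ?a * C2 + ?a * (C' / (?a * ?a)))"
      using a C C2(1) by (simp add: ennreal_mult'[symmetric])
    also have "\<dots> \<le> ennreal (D * real n powr (- q))"
    proof (rule ennreal_leI)
      have "C powr p / ?a + 1 / ?a * C2 + ?a * (C' / (?a * ?a)) = (C powr p + C2 + C') * (1 / ?a)"
        using a(1) by (simp add: field_simps)
      also have "\<dots> \<le> D * (1 / ?a)" unfolding D_def using a(1) C1(1) by (intro mult_right_mono) auto
      finally show "C powr p / ?a + 1 / ?a * C2 + ?a * (C' / (?a * ?a)) \<le> D * real n powr (- q)" unfolding a(2) .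
    qed
    finally show ?thesis .
  qed
  moreover have "0 < D" unfolding D_def using C C1 C2
    by (intro add_pos_nonneg mult_nonneg_nonneg) auto
  ultimately show ?thesis using lam unfolding q_def by blast
qed

end

theorem theorem1:
  fixes M :: "'a measure" and W :: "real \<Rightarrow> 'a \<Rightarrow> real"
  assumes "unit_brownian_motion M W"
  shows "\<forall>r\<ge>1::real. \<forall>p\<ge>1::real. \<exists>lam\<ge>1::real. \<exists>c>0::real. \<forall>n::nat. n \<ge> 1 \<longrightarrow>
    integrable M (\<lambda>\<omega>. \<bar>minimization_error lam n (\<lambda>t. W t \<omega>)\<bar> powr p) \<and>
    (\<integral>\<omega>. \<bar>minimization_error lam n (\<lambda>t. W t \<omega>)\<bar> powr p \<partial>M) powr (1 / p)
      \<le> c * real n powr (- r)"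
proof (intro allI impI)
  interpret unit_brownian_motion M W by fact
  fix r p :: real assume r: "1 \<le> r" and p: "1 \<le> p"
  obtain lam D where lam: "1 \<le> lam" and D: "0 < D" and
    moment: "\<And>n. 1 \<le> n \<Longrightarrow> (\<integral>\<^sup>+\<omega>. ennreal (\<bar>minimization_error lam n (path \<omega>)\<bar> powr p) \<partial>M)
      \<le> ennreal (D * real n powr (- (r * p)))"
    using moment_le[OF r p] by metis
  have "integrable M (\<lambda>\<omega>. \<bar>minimization_error lam n (path \<omega>)\<bar> powr p) \<and>
    (\<integral>\<omega>. \<bar>minimization_error lam n (path \<omega>)\<bar> powr p \<partial>M) powr (1 / p) \<le> D powr (1 / p) * real n powr (- r)"
    if n: "1 \<le> n" for n
  proof
    let ?f = "\<lambda>\<omega>. \<bar>minimization_error lam n (path \<omega>)\<bar> powr p" and ?b = "D * real n powr (- (r * p))"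
    have [measurable]: "(\<lambda>\<omega>. minimization_error lam n (path \<omega>)) \<in> borel_measurable M"
      by (rule minimization_error_measurable[OF n])
    show int: "integrable M ?f"
      using moment[OF n] by (intro integrableI_nonneg) (auto intro: le_less_trans)
    have "ennreal (\<integral>\<omega>. ?f \<omega> \<partial>M) = (\<integral>\<^sup>+\<omega>. ennreal (?f \<omega>) \<partial>M)"
      using int by (intro nn_integral_eq_integral[symmetric]) auto
    also have "\<dots> \<le> ennreal ?b" by (rule moment[OF n])
    finally have "(\<integral>\<omega>. ?f \<omega> \<partial>M) \<le> ?b" using D by (subst (asm) ennreal_le_iff) auto
    then have "(\<integral>\<omega>. ?f \<omega> \<partial>M) powr (1 / p) \<le> ?b powr (1 / p)"
      using p by (intro powr_mono2) (auto intro: integral_nonneg)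
    also have "\<dots> = D powr (1 / p) * real n powr (- r)"
      using D p by (simp add: powr_mult powr_powr)
    finally show "(\<integral>\<omega>. ?f \<omega> \<partial>M) powr (1 / p) \<le> D powr (1 / p) * real n powr (- r)" .
  qed
  moreover have "0 < D powr (1 / p)" using D by simp
  ultimately show "\<exists>lam\<ge>1. \<exists>c>0. \<forall>n::nat. n \<ge> 1 \<longrightarrow>
    integrable M (\<lambda>\<omega>. \<bar>minimization_error lam n (\<lambda>t. W t \<omega>)\<bar> powr p) \<and>
    (\<integral>\<omega>. \<bar>minimization_error lam n (\<lambda>t. W t \<omega>)\<bar> powr p \<partial>M) powr (1 / p) \<le> c * real n powr (- r)"
    using lam by blast
qed

end
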